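(* Let $M$ be a connected and complete Riemannian manifold, let $I(M)$ be its full isometry group, let $G\subset I(M)$ be a subgroup, and let $\bar G$ be the closure of $G$ in $I(M)$. Then all the orbits $G\cdot p$, $p\in M$, are closed in $M$ if and only if the action of $G$ on $M$ is orbit equivalent to the action of $\bar G$ on $M$.
   Context: $I(M)$ carries its usual Lie group topology (the compact-open topology, i.e. uniform convergence on compact sets). Subgroups of $I(M)$ act on $M$ by $(g,p)\mapsto g(p)$, and $G\cdot p=\{g(p):g\in G\}$. Two isometric actions on $M$, of groups $G$ and $H$, are orbit equivalent if they have the same orbits, i.e. $G\cdot p=H\cdot p$ for every $p\in M$. *)

theory Defs
  imports "HOL-Analysis.Analysis" "HOL-Algebra.Group_Action"
begin

section \<open>Smooth maps between open subsets of Euclidean spaces\<close>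

primrec Ck_on :: "nat \<Rightarrow> 'e::euclidean_space set \<Rightarrow> ('e \<Rightarrow> 'f::real_normed_vector) \<Rightarrow> bool" where
  "Ck_on 0 S f \<longleftrightarrow> continuous_on S f"
| "Ck_on (Suc k) S f \<longleftrightarrow>
     (\<forall>x\<in>S. f differentiable (at x)) \<and>
     (\<forall>v. Ck_on k S (\<lambda>x. frechet_derivative f (at x) v))"

definition smooth_on :: "'e::euclidean_space set \<Rightarrow> ('e \<Rightarrow> 'f::real_normed_vector) \<Rightarrow> bool" where
  "smooth_on S f \<longleftrightarrow> (\<forall>k. Ck_on k S f)"


section \<open>Smooth manifolds\<close>

text \<open>
  The manifold is the whole type \<open>'a\<close>, with its type-class topology (Hausdorff and second
  countable), modelled on \<open>'e\<close>.  A chart is a pair of its domain and its coordinate map; the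
  values of the coordinate map outside the domain are irrelevant.
\<close>

type_synonym ('a, 'e) chart = "'a set \<times> ('a \<Rightarrow> 'e)"

definition is_chart :: "('a::topological_space, 'e::euclidean_space) chart \<Rightarrow> bool" where
  "is_chart c \<longleftrightarrow> open (fst c) \<and> open (snd c ` fst c) \<and>
     homeomorphism (fst c) (snd c ` fst c) (snd c) (inv_into (fst c) (snd c))"

text \<open>The expression of a map \<open>f\<close> in a chart \<open>c\<close> of the source and a chart \<open>c'\<close> of the target,
  and the set on which it makes sense.\<close>

definition local_rep ::
  "('a, 'e) chart \<Rightarrow> ('a, 'e) chart \<Rightarrow> ('a \<Rightarrow> 'a) \<Rightarrow> 'e \<Rightarrow> 'e" where
  "local_rep c c' f = snd c' \<circ> f \<circ> inv_into (fst c) (snd c)"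

definition rep_dom ::
  "('a, 'e) chart \<Rightarrow> ('a, 'e) chart \<Rightarrow> ('a \<Rightarrow> 'a) \<Rightarrow> 'e set" where
  "rep_dom c c' f = snd c ` (fst c \<inter> f -` fst c')"

definition smooth_map ::
  "('a::topological_space, 'e::euclidean_space) chart set \<Rightarrow> ('a \<Rightarrow> 'a) \<Rightarrow> bool" where
  "smooth_map A f \<longleftrightarrow> continuous_on UNIV f \<and>
     (\<forall>c\<in>A. \<forall>c'\<in>A. smooth_on (rep_dom c c' f) (local_rep c c' f))"

text \<open>The atlas need not be maximal.  Since \<open>local_rep c c' id\<close> is the transition map from \<open>c\<close>
  to \<open>c'\<close>, the last conjunct is the smooth compatibility of the charts.\<close>

definition smooth_atlas ::
  "('a::{t2_space,second_countable_topology}, 'e::euclidean_space) chart set \<Rightarrow> bool" where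
  "smooth_atlas A \<longleftrightarrow> (\<forall>c\<in>A. is_chart c) \<and> (\<Union>c\<in>A. fst c) = UNIV \<and> smooth_map A id"

definition diffeomorphism ::
  "('a::topological_space, 'e::euclidean_space) chart set \<Rightarrow> ('a \<Rightarrow> 'a) \<Rightarrow> bool" where
  "diffeomorphism A f \<longleftrightarrow> bij f \<and> smooth_map A f \<and> smooth_map A (inv_into UNIV f)"


section \<open>Riemannian metrics\<close>

text \<open>
  A metric is given by its components in each chart: \<open>g c x u v\<close> is the inner product, at the
  point with coordinates \<open>x\<close> in \<open>c\<close>, of the tangent vectors with components \<open>u\<close> and \<open>v\<close>
  in \<open>c\<close>.
\<close>

type_synonym ('a, 'e) metric_tensor = "('a, 'e) chart \<Rightarrow> 'e \<Rightarrow> 'e \<Rightarrow> 'e \<Rightarrow> real"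

text \<open>\<open>f\<^sup>*g = g\<close>, written in charts.\<close>

definition preserves_metric ::
  "('a, 'e::euclidean_space) chart set \<Rightarrow> ('a, 'e) metric_tensor \<Rightarrow> ('a \<Rightarrow> 'a) \<Rightarrow> bool" where
  "preserves_metric A g f \<longleftrightarrow>
     (\<forall>c\<in>A. \<forall>c'\<in>A. \<forall>x\<in>rep_dom c c' f. \<forall>u v.
        g c' (local_rep c c' f x)
          (frechet_derivative (local_rep c c' f) (at x) u)
          (frechet_derivative (local_rep c c' f) (at x) v) = g c x u v)"

text \<open>\<open>preserves_metric A g id\<close> is the transformation law of a covariant 2-tensor under change
  of charts.\<close>

definition riemannian_metric ::
  "('a, 'e::euclidean_space) chart set \<Rightarrow> ('a, 'e) metric_tensor \<Rightarrow> bool" where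
  "riemannian_metric A g \<longleftrightarrow>
     (\<forall>c\<in>A. \<forall>x\<in>snd c ` fst c.
        bilinear (g c x) \<and> (\<forall>u v. g c x u v = g c x v u) \<and> (\<forall>u. u \<noteq> 0 \<longrightarrow> g c x u u > 0)) \<and>
     (\<forall>c\<in>A. \<forall>u v. smooth_on (snd c ` fst c) (\<lambda>x. g c x u v)) \<and>
     preserves_metric A g id"

definition riemannian_manifold ::
  "('a::{t2_space,second_countable_topology}, 'e::euclidean_space) chart set
     \<Rightarrow> ('a, 'e) metric_tensor \<Rightarrow> bool" where
  "riemannian_manifold A g \<longleftrightarrow> smooth_atlas A \<and> riemannian_metric A g"


section \<open>Riemannian distance and completeness\<close>

text \<open>Continuous differentiability up to the end points, where derivatives are one-sided.\<close>

definition C1_curve ::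
  "('a::topological_space, 'e::euclidean_space) chart set \<Rightarrow> real \<Rightarrow> real \<Rightarrow> (real \<Rightarrow> 'a) \<Rightarrow> bool"
  where
  "C1_curve A a b \<gamma> \<longleftrightarrow> continuous_on {a..b} \<gamma> \<and>
     (\<forall>c\<in>A. \<exists>D. continuous_on ({a..b} \<inter> \<gamma> -` fst c) D \<and>
        (\<forall>t\<in>{a..b} \<inter> \<gamma> -` fst c.
           ((snd c \<circ> \<gamma>) has_vector_derivative D t) (at t within {a..b})))"

definition piecewise_C1_curve ::
  "('a::topological_space, 'e::euclidean_space) chart set \<Rightarrow> (real \<Rightarrow> 'a) \<Rightarrow> bool" where
  "piecewise_C1_curve A \<gamma> \<longleftrightarrow>
     (\<exists>(n::nat) t. t 0 = 0 \<and> t n = 1 \<and> (\<forall>i<n. t i < t (Suc i)) \<and>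
        (\<forall>i<n. C1_curve A (t i) (t (Suc i)) \<gamma>))"

text \<open>By the transformation law of \<open>g\<close>, the speed does not depend on the chart that is chosen.
  At the finitely many times where the curve is not differentiable its value is
  irrelevant for the length.\<close>

definition speed ::
  "('a, 'e::euclidean_space) chart set \<Rightarrow> ('a, 'e) metric_tensor \<Rightarrow> (real \<Rightarrow> 'a) \<Rightarrow> real \<Rightarrow> real"
  where
  "speed A g \<gamma> t =
     (let c = (SOME c. c \<in> A \<and> \<gamma> t \<in> fst c);
          w = vector_derivative (snd c \<circ> \<gamma>) (at t)
      in sqrt (g c (snd c (\<gamma> t)) w w))"

definition curve_length ::
  "('a, 'e::euclidean_space) chart set \<Rightarrow> ('a, 'e) metric_tensor \<Rightarrow> (real \<Rightarrow> 'a) \<Rightarrow> real" where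
  "curve_length A g \<gamma> = integral {0..1} (speed A g \<gamma>)"

definition riemannian_dist ::
  "('a::topological_space, 'e::euclidean_space) chart set \<Rightarrow> ('a, 'e) metric_tensor
     \<Rightarrow> 'a \<Rightarrow> 'a \<Rightarrow> real" where
  "riemannian_dist A g p q =
     Inf {curve_length A g \<gamma> | \<gamma>. piecewise_C1_curve A \<gamma> \<and> \<gamma> 0 = p \<and> \<gamma> 1 = q}"

definition complete_riemannian ::
  "('a::topological_space, 'e::euclidean_space) chart set \<Rightarrow> ('a, 'e) metric_tensor \<Rightarrow> bool" where
  "complete_riemannian A g \<longleftrightarrow> Metric_space.mcomplete UNIV (riemannian_dist A g)"


section \<open>The isometry group and its topology\<close>

definition isometries ::
  "('a::topological_space, 'e::euclidean_space) chart set \<Rightarrow> ('a, 'e) metric_tensor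
     \<Rightarrow> ('a \<Rightarrow> 'a) set" where
  "isometries A g = {f. diffeomorphism A f \<and> preserves_metric A g f}"

definition isometry_group ::
  "('a::topological_space, 'e::euclidean_space) chart set \<Rightarrow> ('a, 'e) metric_tensor
     \<Rightarrow> ('a \<Rightarrow> 'a) monoid" where
  "isometry_group A g = \<lparr>carrier = isometries A g, mult = (\<circ>), one = id\<rparr>"

definition compact_open_topology ::
  "('a::topological_space \<Rightarrow> 'b::topological_space) topology" where
  "compact_open_topology =
     subtopology (topology_generated_by {{f. f ` K \<subseteq> U} | K U. compact K \<and> open U})
       {f. continuous_on UNIV f}"

definition isometry_topology ::
  "('a::topological_space, 'e::euclidean_space) chart set \<Rightarrow> ('a, 'e) metric_tensor
     \<Rightarrow> ('a \<Rightarrow> 'a) topology" where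
  "isometry_topology A g = subtopology compact_open_topology (isometries A g)"

definition subgroup_action_orbit ::
  "('a::topological_space, 'e::euclidean_space) chart set \<Rightarrow> ('a, 'e) metric_tensor
     \<Rightarrow> ('a \<Rightarrow> 'a) set \<Rightarrow> 'a \<Rightarrow> 'a set" where
  "subgroup_action_orbit A g H p = orbit (isometry_group A g\<lparr>carrier := H\<rparr>) (\<lambda>f. f) p"

definition orbit_equivalent ::
  "('a::topological_space, 'e::euclidean_space) chart set \<Rightarrow> ('a, 'e) metric_tensor
     \<Rightarrow> ('a \<Rightarrow> 'a) set \<Rightarrow> ('a \<Rightarrow> 'a) set \<Rightarrow> bool" where
  "orbit_equivalent A g G H \<longleftrightarrow>
     (\<forall>p. subgroup_action_orbit A g G p = subgroup_action_orbit A g H p)"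

end

theory Submission
  imports Defs "HOL-Complex_Analysis.Great_Picard" "HOL-Library.Diagonal_Subsequence"
begin

text \<open>
  Evaluation at a point is continuous in the compact-open topology, so the orbits of the closure of
  \<open>G\<close> lie in the closures of the orbits of \<open>G\<close>.  For the converse let \<open>f\<^sub>n p \<longlonglongrightarrow> q\<close> with \<open>f\<^sub>n \<in> G\<close>; it
  suffices to find a subsequence converging to an isometry, whose value at \<open>p\<close> is then \<open>q\<close>.
  Isometries are uniformly Lipschitz in charts, so the set of points with relatively compact
  \<open>{f\<^sub>n x}\<close> is open, and applying \<open>f\<^sub>m\<^sup>-\<^sup>1 \<circ> f\<^sub>n\<close> shows that it is closed; by connectedness it is everything,
  and a diagonal subsequence converges locally uniformly, together with the inverses.
  The limit is smooth because the Koszul formula expresses the second derivatives of an isometry as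
  a smooth function of the point, the value and the first derivative: this bounds the second
  derivatives of the \<open>f\<^sub>n\<close>, so the first derivatives converge uniformly along a subsequence, the
  limit satisfies the same equation, and bootstrapping gives smoothness of all orders.
\<close>


section \<open>Calculus of \<open>C\<^sup>k\<close> maps\<close>

text \<open>The obstacle is a gap in regularity: convergence in the group is only of order zero,
  whereas an isometry is a diffeomorphism whose first derivatives preserve a tensor. All estimates
  up to pointwise convergence are therefore made for maps that are merely differentiable and
  metric-preserving (\<open>loc_isom\<close>), a class closed under composition and containing the
  inverses of isometries. For it a neighbourhood form of equicontinuity holds, with neighbourhoods
  independent of the map, so that the limit arguments on the manifold need only its topology.
  Regularity is regained by solving the Koszul identity with the metric of the source: the
  right-hand side then makes sense for every linear map in place of the derivative, invertible or
  not, and is continuous on a compact set containing all triples of point, value and derivative. The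
  inverses need a convergent subsequence of their own because a limit of bijections need not be
  bijective.\<close>

abbreviation fder :: "('e::real_normed_vector \<Rightarrow> 'f::real_normed_vector) \<Rightarrow> 'e \<Rightarrow> 'e \<Rightarrow> 'f" where
  "fder f x \<equiv> frechet_derivative f (at x)"

lemma fder_works: "f differentiable (at x) \<Longrightarrow> (f has_derivative fder f x) (at x)"
  using frechet_derivative_works by blast

lemma fder_eq: "(f has_derivative f') (at x) \<Longrightarrow> fder f x = f'"
  using frechet_derivative_at by metis

lemma Ck_on_cong:
  assumes "open S" "\<And>x. x \<in> S \<Longrightarrow> f x = g x" "Ck_on k S f"
  shows "Ck_on k S g"
  using assms(2,3)
proof (induction k arbitrary: f g)
  case 0
  then show ?case using continuous_on_cong by force
next
  case (Suc k)
  have d: "f differentiable (at x)" if "x \<in> S" for x using Suc that by simp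
  have "(g has_derivative fder f x) (at x)" if "x \<in> S" for x
    using has_derivative_transform_within_open[OF fder_works[OF d[OF that]] \<open>open S\<close> that] Suc.prems(1)
    by blast
  then have "g differentiable (at x)" "fder g x = fder f x" if "x \<in> S" for x
    using that fder_eq by (auto simp: differentiable_def)
  moreover have "Ck_on k S (\<lambda>x. fder g x v)" for v
    by (rule Suc.IH[of "\<lambda>x. fder f x v"]) (use Suc.prems(2) calculation in auto)
  ultimately show ?case by simp
qed

lemma Ck_on_SucI:
  assumes "open S" "\<And>x. x \<in> S \<Longrightarrow> (f has_derivative f' x) (at x)"
    and "\<And>v. Ck_on k S (\<lambda>x. f' x v)"
  shows "Ck_on (Suc k) S f"
proof -
  have "fder f x = f' x" if "x \<in> S" for x using assms(2) that fder_eq by blast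
  then have "Ck_on k S (\<lambda>x. fder f x v)" for v
    using Ck_on_cong[OF assms(1) _ assms(3)[of v]] by simp
  then show ?thesis using assms(2) by (auto simp: differentiable_def)
qed

lemma Ck_on_SucD:
  assumes "Ck_on (Suc k) S f"
  shows "\<And>x. x \<in> S \<Longrightarrow> f differentiable (at x)"
    and "\<And>x. x \<in> S \<Longrightarrow> (f has_derivative fder f x) (at x)"
    and "Ck_on k S (\<lambda>x. fder f x v)"
  using assms fder_works by auto

lemma Ck_on_Suc_imp: "Ck_on (Suc k) S f \<Longrightarrow> Ck_on k S f"
proof (induction k arbitrary: f)
  case 0
  then show ?case
    by (auto intro!: continuous_at_imp_continuous_on differentiable_imp_continuous_within)
next
  case (Suc k)
  show ?case using Suc.IH Ck_on_SucD[OF Suc.prems] by simp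
qed

lemma Ck_on_subset: "Ck_on k S f \<Longrightarrow> T \<subseteq> S \<Longrightarrow> Ck_on k T f"
  by (induction k arbitrary: f) (auto intro: continuous_on_subset)

lemma Ck_on_local:
  assumes "\<And>x. x \<in> S \<Longrightarrow> \<exists>T. open T \<and> x \<in> T \<and> Ck_on k T f"
  shows "Ck_on k S f"
  using assms
proof (induction k arbitrary: f)
  case 0
  show ?case
    unfolding Ck_on.simps
  proof (rule continuous_at_imp_continuous_on, rule ballI)
    fix x assume "x \<in> S"
    then obtain T where "open T" "x \<in> T" "continuous_on T f" using 0 by force
    then show "isCont f x" by (simp add: continuous_on_eq_continuous_at)
  qed
next
  case (Suc k)
  have "Ck_on k S (\<lambda>x. fder f x v)" for v
    by (rule Suc.IH) (use Suc.prems in force)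
  then show ?case using Suc.prems by force
qed

lemma Ck_on_imp_continuous: "Ck_on k S f \<Longrightarrow> continuous_on S f"
  by (induction k) (auto dest: Ck_on_Suc_imp simp del: Ck_on.simps(2))

lemma Ck_on_const [intro, simp]: "Ck_on k S (\<lambda>x. c)"
  by (induction k arbitrary: c) auto

lemma Ck_on_bounded_linear:
  assumes "bounded_linear f" "open S"
  shows "Ck_on k S f"
proof (cases k)
  case 0
  then show ?thesis using assms by (simp add: linear_continuous_on)
next
  case (Suc j)
  show ?thesis unfolding Suc
    by (rule Ck_on_SucI[where f' = "\<lambda>x. f"])
      (use assms in \<open>auto intro!: bounded_linear_imp_has_derivative\<close>)
qed

lemma Ck_on_compose_bounded_linear:
  assumes "bounded_linear h" "open S" "Ck_on k S f"
  shows "Ck_on k S (\<lambda>x. h (f x))"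
  using assms(3)
proof (induction k arbitrary: f)
  case 0
  then show ?case by (simp add: bounded_linear.continuous_on[OF assms(1)])
next
  case (Suc k)
  show ?case
  proof (rule Ck_on_SucI[OF assms(2), where f' = "\<lambda>x v. h (fder f x v)"])
    show "((\<lambda>x. h (f x)) has_derivative (\<lambda>v. h (fder f x v))) (at x)" if "x \<in> S" for x
      by (rule bounded_linear.has_derivative[OF assms(1) Ck_on_SucD(2)[OF Suc.prems that]])
    show "Ck_on k S (\<lambda>x. h (fder f x v))" for v
      by (rule Suc.IH[OF Ck_on_SucD(3)[OF Suc.prems]])
  qed
qed

lemma Ck_on_add:
  assumes "open S" "Ck_on k S f" "Ck_on k S g"
  shows "Ck_on k S (\<lambda>x. f x + g x)"
  using assms(2,3)
proof (induction k arbitrary: f g)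
  case 0
  then show ?case by (auto intro!: continuous_intros)
next
  case (Suc k)
  show ?case
    by (rule Ck_on_SucI[OF assms(1), where f' = "\<lambda>x v. fder f x v + fder g x v"])
      (use Ck_on_SucD[OF Suc.prems(1)] Ck_on_SucD[OF Suc.prems(2)] Suc.IH in 
        \<open>auto intro!: has_derivative_add\<close>)
qed

lemma Ck_on_sum:
  assumes "open S" "\<And>i. i \<in> I \<Longrightarrow> Ck_on k S (f i)"
  shows "Ck_on k S (\<lambda>x. \<Sum>i\<in>I. f i x)"
proof (cases "finite I")
  case True
  then show ?thesis using assms(2)
    by (induction I rule: finite_induct) (auto intro: Ck_on_add[OF assms(1)])
qed auto

lemma Ck_on_bilinear:
  assumes "bounded_bilinear p" "open S" "Ck_on k S f" "Ck_on k S g"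
  shows "Ck_on k S (\<lambda>x. p (f x) (g x))"
  using assms(3,4)
proof (induction k arbitrary: f g)
  case 0
  then show ?case by (simp add: bounded_bilinear.continuous_on[OF assms(1)])
next
  case (Suc k)
  show ?case
  proof (rule Ck_on_SucI[OF assms(2), where f' = "\<lambda>x v. p (f x) (fder g x v) + p (fder f x v) (g x)"])
    show "((\<lambda>x. p (f x) (g x)) has_derivative (\<lambda>v. p (f x) (fder g x v) + p (fder f x v) (g x))) (at x)"
      if "x \<in> S" for x
      using bounded_bilinear.FDERIV[OF assms(1)] Ck_on_SucD(2)[OF Suc.prems(1) that]
        Ck_on_SucD(2)[OF Suc.prems(2) that] by blast
    show "Ck_on k S (\<lambda>x. p (f x) (fder g x v) + p (fder f x v) (g x))" for v
      by (intro Ck_on_add[OF assms(2)] Suc.IH Ck_on_SucD(3) Suc.prems Ck_on_Suc_imp)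
  qed
qed

lemmas Ck_on_mult = Ck_on_bilinear[OF bounded_bilinear_mult]
lemmas Ck_on_scaleR = Ck_on_bilinear[OF bounded_bilinear_scaleR]

lemma Ck_on_minus:
  assumes "open S" "Ck_on k S f" "Ck_on k S g"
  shows "Ck_on k S (\<lambda>x. f x - g x)"
  using Ck_on_add[OF assms(1,2) Ck_on_compose_bounded_linear[OF _ assms(1,3), of uminus]]
    bounded_linear_minus[OF bounded_linear_ident] by simp

lemma Ck_on_inner_const:
  assumes "open S" "Ck_on k S f"
  shows "Ck_on k S (\<lambda>x. f x \<bullet> c)"
  by (rule Ck_on_compose_bounded_linear[OF _ assms]) (rule bounded_linear_inner_left)

lemma linear_eq_sum_Basis:
  fixes f :: "'e::euclidean_space \<Rightarrow> 'f::real_vector"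
  assumes "linear f"
  shows "f v = (\<Sum>i\<in>Basis. (v \<bullet> i) *\<^sub>R f i)"
proof -
  have "f v = f (\<Sum>i\<in>Basis. (v \<bullet> i) *\<^sub>R i)" by (simp add: euclidean_representation)
  then show ?thesis by (simp add: linear_sum[OF assms] linear_scale[OF assms])
qed

text \<open>\<open>Ck_on\<close> controls derivatives in fixed directions only, whereas the chain
  rule produces \<open>fder h (f x)\<close> in the moving direction \<open>fder f x v\<close>.
  Expanding that direction in the basis leaves products to which the induction hypothesis
  applies.\<close>

lemma Ck_on_compose:
  fixes f :: "'e::euclidean_space \<Rightarrow> 'd::euclidean_space" and h :: "'d \<Rightarrow> 'f::real_normed_vector"
  assumes "open S" "open T" "f ` S \<subseteq> T" "Ck_on k T h" "Ck_on k S f"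
  shows "Ck_on k S (\<lambda>x. h (f x))"
  using assms(4,5)
proof (induction k arbitrary: h)
  case 0
  then show ?case using continuous_on_compose2 assms(3) by fastforce
next
  case (Suc k)
  show ?case
  proof (rule Ck_on_SucI[OF assms(1), where f' = "\<lambda>x v. \<Sum>i\<in>Basis. (fder f x v \<bullet> i) *\<^sub>R fder h (f x) i"])
    fix x assume x: "x \<in> S"
    then have hd: "(h has_derivative fder h (f x)) (at (f x))"
      using Ck_on_SucD(2)[OF Suc.prems(1)] assms(3) by blast
    have "((\<lambda>x. h (f x)) has_derivative (\<lambda>v. fder h (f x) (fder f x v))) (at x)"
      using has_derivative_compose[OF Ck_on_SucD(2)[OF Suc.prems(2) x] hd] by simp
    moreover have "fder h (f x) (fder f x v) = (\<Sum>i\<in>Basis. (fder f x v \<bullet> i) *\<^sub>R fder h (f x) i)" for v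
      by (rule linear_eq_sum_Basis) (use hd has_derivative_linear in blast)
    ultimately show "((\<lambda>x. h (f x)) has_derivative
        (\<lambda>v. \<Sum>i\<in>Basis. (fder f x v \<bullet> i) *\<^sub>R fder h (f x) i)) (at x)" by simp
  next
    show "Ck_on k S (\<lambda>x. \<Sum>i\<in>Basis. (fder f x v \<bullet> i) *\<^sub>R fder h (f x) i)" for v
      by (intro Ck_on_sum Ck_on_scaleR Ck_on_inner_const assms(1) Ck_on_SucD(3)[OF Suc.prems(2)]
          Suc.IH Ck_on_SucD(3)[OF Suc.prems(1)] Ck_on_Suc_imp[OF Suc.prems(2)])
  qed
qed

section \<open>Symmetry of second derivatives\<close>

text \<open>The mean value theorem is used twice: along \<open>w\<close> for the increment in
  direction \<open>u\<close>, then along \<open>u\<close> for the derivative in direction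
  \<open>w\<close>. The quotient thus equals the iterated derivative at an intermediate point, and
  continuity at \<open>x\<close> finishes. Its value is that it is symmetric in \<open>u\<close> and
  \<open>w\<close>.\<close>

lemma second_difference_tendsto:
  fixes f :: "'e::euclidean_space \<Rightarrow> real"
  assumes "open S" "Ck_on 2 S f" "x \<in> S"
  shows "((\<lambda>t. (f (x + t *\<^sub>R w + t *\<^sub>R u) - f (x + t *\<^sub>R w) - f (x + t *\<^sub>R u) + f x) / t\<^sup>2)
           \<longlongrightarrow> fder (\<lambda>y. fder f y w) x u) (at_right 0)"
proof (rule tendstoI)
  fix e :: real assume "e > 0"
  have C2: "Ck_on (Suc (Suc 0)) S f" using assms(2) by (simp add: numeral_2_eq_2)
  note d1 = Ck_on_SucD(2)[OF C2]
  note d2 = Ck_on_SucD(2)[OF Ck_on_SucD(3)[OF C2, of w]]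
  have "continuous_on S (\<lambda>y. fder (\<lambda>y. fder f y w) y u)" using C2 by simp
  then have "isCont (\<lambda>y. fder (\<lambda>y. fder f y w) y u) x"
    using assms(1,3) continuous_on_eq_continuous_at by blast
  then obtain d0 where d0: "d0 > 0" "\<And>y. dist y x < d0 \<Longrightarrow>
      dist (fder (\<lambda>y. fder f y w) y u) (fder (\<lambda>y. fder f y w) x u) < e"
    using \<open>e > 0\<close> by (auto simp: continuous_at_eps_delta)
  obtain d1 where d1': "d1 > 0" "ball x d1 \<subseteq> S" using assms openE by blast
  \<comment> \<open>For \<open>t < d\<close> the whole parallelogram stays in \<open>S\<close> and
    in the continuity ball. The summand 1 keeps the denominator positive when
    \<open>u = w = 0\<close>.\<close>
  define d where "d = min d0 d1 / (norm w + norm u + 1)"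
  have "d > 0" using d0 d1' by (simp add: d_def add_nonneg_pos)
  have near: "dist (x + s *\<^sub>R w + r *\<^sub>R u) x < min d0 d1" 
    if "0 \<le> s" "s \<le> t" "0 \<le> r" "r \<le> t" "t < d" for s r t
  proof -
    have "dist (x + s *\<^sub>R w + r *\<^sub>R u) x \<le> norm (s *\<^sub>R w) + norm (r *\<^sub>R u)"
      by (metis add.assoc add_diff_cancel_left' dist_norm norm_triangle_ineq)
    also have "\<dots> \<le> t * norm w + t * norm u" using that by (auto intro!: add_mono mult_right_mono)
    also have "\<dots> \<le> t * (norm w + norm u + 1)" using that by (simp add: algebra_simps)
    also have "\<dots> < d * (norm w + norm u + 1)" using that by (simp add: add_nonneg_pos)
    also have "\<dots> = min d0 d1" 
      using add_nonneg_pos[of "norm w + norm u" 1] by (simp add: d_def)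
    finally show ?thesis .
  qed
  have inS: "x + s *\<^sub>R w + r *\<^sub>R u \<in> S" if "0 \<le> s" "s \<le> t" "0 \<le> r" "r \<le> t" "t < d" for s r t
    using near[OF that] d1'(2) by (auto simp: dist_commute)
  have main: "dist ((f (x + t *\<^sub>R w + t *\<^sub>R u) - f (x + t *\<^sub>R w) - f (x + t *\<^sub>R u) + f x) / t\<^sup>2)
        (fder (\<lambda>y. fder f y w) x u) < e" if t: "0 < t" "t < d" for t
  proof -
    define \<psi> where "\<psi> = (\<lambda>s. f (x + s *\<^sub>R w + t *\<^sub>R u) - f (x + s *\<^sub>R w))"
    have psi1: "((\<lambda>s. f (x + s *\<^sub>R w + t *\<^sub>R u) - f (x + s *\<^sub>R w)) has_derivative
        (\<lambda>h. fder f (x + s *\<^sub>R w + t *\<^sub>R u) (h *\<^sub>R w) - fder f (x + s *\<^sub>R w) (h *\<^sub>R w))) (at s within {0..t})"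
      if s: "0 \<le> s" "s \<le> t" for s
    proof (rule has_derivative_diff)
      have "((\<lambda>s. x + s *\<^sub>R w + t *\<^sub>R u) has_derivative (\<lambda>h. h *\<^sub>R w)) (at s within {0..t})"
        by (auto intro!: derivative_eq_intros)
      from has_derivative_compose[OF this d1[OF inS]]
      show "((\<lambda>s. f (x + s *\<^sub>R w + t *\<^sub>R u)) has_derivative
        (\<lambda>h. fder f (x + s *\<^sub>R w + t *\<^sub>R u) (h *\<^sub>R w))) (at s within {0..t})" using s t by auto
      have "((\<lambda>s. x + s *\<^sub>R w) has_derivative (\<lambda>h. h *\<^sub>R w)) (at s within {0..t})"
        by (auto intro!: derivative_eq_intros)
      from has_derivative_compose[OF this d1]
      show "((\<lambda>s. f (x + s *\<^sub>R w)) has_derivative (\<lambda>h. fder f (x + s *\<^sub>R w) (h *\<^sub>R w))) (at s within {0..t})"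
        using inS[of s t 0] s t by auto
    qed
    have psi2: "fder f (x + s *\<^sub>R w + t *\<^sub>R u) (h *\<^sub>R w) - fder f (x + s *\<^sub>R w) (h *\<^sub>R w)
        = h * (fder f (x + s *\<^sub>R w + t *\<^sub>R u) w - fder f (x + s *\<^sub>R w) w)"
      if "0 \<le> s" "s \<le> t" for s h
    proof -
      have "x + s *\<^sub>R w + t *\<^sub>R u \<in> S" "x + s *\<^sub>R w \<in> S"
        using inS[of s t t] inS[of s t 0] that t by auto
      then show ?thesis
        by (simp add: d1[THEN has_derivative_linear, THEN linear_scale] algebra_simps)
    qed
    have "(\<psi> has_derivative
        (\<lambda>h. h * (fder f (x + s *\<^sub>R w + t *\<^sub>R u) w - fder f (x + s *\<^sub>R w) w))) (at s within {0..t})"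
      if "0 \<le> s" "s \<le> t" for s
      unfolding \<psi>_def using psi1[OF that] by (simp only: psi2[OF that])
    from mvt_very_simple[OF less_imp_le[OF t(1)] this]
    obtain s where s: "0 \<le> s" "s \<le> t" 
      "\<psi> t - \<psi> 0 = t * (fder f (x + s *\<^sub>R w + t *\<^sub>R u) w - fder f (x + s *\<^sub>R w) w)"
      by auto
    define \<eta> where "\<eta> = (\<lambda>r. fder f (x + s *\<^sub>R w + r *\<^sub>R u) w)"
    have "(\<eta> has_derivative (\<lambda>h. h * (fder (\<lambda>y. fder f y w) (x + s *\<^sub>R w + r *\<^sub>R u) u))) (at r within {0..t})"
      if r: "0 \<le> r" "r \<le> t" for r
    proof -
      have "((\<lambda>r. x + s *\<^sub>R w + r *\<^sub>R u) has_derivative (\<lambda>h. h *\<^sub>R u)) (at r within {0..t})"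
        by (auto intro!: derivative_eq_intros)
      from has_derivative_compose[OF this d2[OF inS]]
      show ?thesis using d2[THEN has_derivative_linear, THEN linear_scale, OF inS, of s t r] s r t 
        by (auto simp: \<eta>_def)
    qed
    from mvt_very_simple[OF less_imp_le[OF t(1)] this]
    obtain r where r: "0 \<le> r" "r \<le> t" 
      "\<eta> t - \<eta> 0 = t * (fder (\<lambda>y. fder f y w) (x + s *\<^sub>R w + r *\<^sub>R u) u)"
      by auto
    have "\<psi> t - \<psi> 0 = t * (t * fder (\<lambda>y. fder f y w) (x + s *\<^sub>R w + r *\<^sub>R u) u)"
      using s(3) r(3) by (simp add: \<eta>_def)
    then have "(f (x + t *\<^sub>R w + t *\<^sub>R u) - f (x + t *\<^sub>R w) - f (x + t *\<^sub>R u) + f x) / t\<^sup>2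
      = fder (\<lambda>y. fder f y w) (x + s *\<^sub>R w + r *\<^sub>R u) u"
      using t by (simp add: \<psi>_def power2_eq_square field_simps)
    then show ?thesis using d0(2) near[OF s(1,2) r(1,2) t(2)] by simp
  qed
  show "\<forall>\<^sub>F t in at_right 0. dist ((f (x + t *\<^sub>R w + t *\<^sub>R u) - f (x + t *\<^sub>R w) - f (x + t *\<^sub>R u) + f x) / t\<^sup>2)
          (fder (\<lambda>y. fder f y w) x u) < e"
    using eventually_at_right_less[of 0] eventually_at_right_real[OF \<open>d > 0\<close>] 
    by (auto elim!: eventually_mono intro: main)
qed

text \<open>Both sides are limits of the same difference quotient. The passage to components is due
  to the mean value theorem, which is an equality only for real-valued functions.\<close>

lemma second_derivative_symmetric:
  fixes f :: "'e::euclidean_space \<Rightarrow> 'd::euclidean_space"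
  assumes "open S" "Ck_on 2 S f" "x \<in> S"
  shows "fder (\<lambda>y. fder f y w) x u = fder (\<lambda>y. fder f y u) x w"
proof (rule euclidean_eqI)
  fix i :: 'd assume "i \<in> Basis"
  define \<phi> where "\<phi> = (\<lambda>y. f y \<bullet> i)"
  have C2: "Ck_on (Suc (Suc 0)) S f" using assms(2) by (simp add: numeral_2_eq_2)
  have phi: "Ck_on 2 S \<phi>" unfolding \<phi>_def by (rule Ck_on_inner_const[OF assms(1,2)])
  have f1: "fder \<phi> y v = fder f y v \<bullet> i" if "y \<in> S" for y v
    using fder_eq[OF has_derivative_inner_left[OF Ck_on_SucD(2)[OF C2 that], of i]]
    unfolding \<phi>_def by metis
  have f2: "fder (\<lambda>y. fder \<phi> y v) x v' = fder (\<lambda>y. fder f y v) x v' \<bullet> i" for v v'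
  proof -
    have "((\<lambda>y. fder f y v \<bullet> i) has_derivative (\<lambda>v'. fder (\<lambda>y. fder f y v) x v' \<bullet> i)) (at x)"
      by (rule has_derivative_inner_left[OF Ck_on_SucD(2)[OF Ck_on_SucD(3)[OF C2] assms(3)]])
    from has_derivative_transform_within_open[OF this assms(1,3), of "\<lambda>y. fder \<phi> y v"]
    show ?thesis using f1 fder_eq by metis
  qed
  have "fder (\<lambda>y. fder \<phi> y w) x u = fder (\<lambda>y. fder \<phi> y u) x w"
  proof (rule tendsto_unique[OF trivial_limit_at_right_real second_difference_tendsto[OF assms(1) phi assms(3)]])
    have "((\<lambda>t. (\<phi> (x + t *\<^sub>R u + t *\<^sub>R w) - \<phi> (x + t *\<^sub>R u) - \<phi> (x + t *\<^sub>R w) + \<phi> x) / t\<^sup>2)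
           \<longlongrightarrow> fder (\<lambda>y. fder \<phi> y u) x w) (at_right 0)"
      by (rule second_difference_tendsto[OF assms(1) phi assms(3)])
    then show "((\<lambda>t. (\<phi> (x + t *\<^sub>R w + t *\<^sub>R u) - \<phi> (x + t *\<^sub>R w) - \<phi> (x + t *\<^sub>R u) + \<phi> x) / t\<^sup>2)
           \<longlongrightarrow> fder (\<lambda>y. fder \<phi> y u) x w) (at_right 0)"
      by (simp add: algebra_simps)
  qed
  then show "fder (\<lambda>y. fder f y w) x u \<bullet> i = fder (\<lambda>y. fder f y u) x w \<bullet> i"
    by (simp add: f2)
qed

section \<open>Linear equations for positive definite forms\<close>

definition posdef_form :: "('e::euclidean_space \<Rightarrow> 'e \<Rightarrow> real) \<Rightarrow> bool" where
  "posdef_form \<gamma> \<longleftrightarrow> bilinear \<gamma> \<and> (\<forall>u v. \<gamma> u v = \<gamma> v u) \<and> (\<forall>u. u \<noteq> 0 \<longrightarrow> \<gamma> u u > 0)"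

lemma bilinear_eq_sum_Basis:
  fixes \<gamma> :: "'e::euclidean_space \<Rightarrow> 'd::euclidean_space \<Rightarrow> real"
  assumes "bilinear \<gamma>"
  shows "\<gamma> u v = (\<Sum>i\<in>Basis. \<Sum>j\<in>Basis. (u \<bullet> i) * (v \<bullet> j) * \<gamma> i j)"
proof -
  have l: "linear (\<lambda>x. \<gamma> x v)" "linear (\<gamma> i)" for i using assms by (auto simp: bilinear_def)
  show ?thesis
    by (subst linear_eq_sum_Basis[OF l(1)], subst linear_eq_sum_Basis[OF l(2)])
      (simp add: sum_distrib_left mult.assoc)
qed

lemma posdef_form_eqI:
  assumes "posdef_form \<gamma>" "\<And>v. \<gamma> a v = \<gamma> b v"
  shows "a = b"
proof (rule ccontr)
  assume "a \<noteq> b"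
  then have "\<gamma> (a - b) (a - b) > 0" using assms(1) by (simp add: posdef_form_def)
  then show False using assms(1) assms(2)[of "a - b"] by (simp add: posdef_form_def bilinear_lsub)
qed

text \<open>The Riesz representative of \<open>b\<close> for the inner product
  \<open>\<gamma>\<close> ("raising an index"). For a positive definite form and a linear
  \<open>b\<close> the choice is forced: such a vector exists and is unique.\<close>

definition form_solve :: "('e::euclidean_space \<Rightarrow> 'e \<Rightarrow> real) \<Rightarrow> ('e \<Rightarrow> real) \<Rightarrow> 'e" where
  "form_solve \<gamma> b = (SOME a. \<forall>v. \<gamma> a v = b v)"

lemma form_solve:
  assumes "posdef_form \<gamma>" "linear b"
  shows "\<gamma> (form_solve \<gamma> b) v = b v"
proof -
  \<comment> \<open>The Gram operator of \<open>\<gamma>\<close> with respect to the Euclidean inner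
    product; definiteness makes it injective, hence surjective in finite dimension.\<close>
  define T where "T = (\<lambda>a. \<Sum>i\<in>Basis. \<gamma> a i *\<^sub>R i)"
  have bil: "bilinear \<gamma>" using assms(1) by (simp add: posdef_form_def)
  have T: "T a \<bullet> v = \<gamma> a v" for a v
  proof -
    have "T a \<bullet> v = (\<Sum>i\<in>Basis. (v \<bullet> i) *\<^sub>R \<gamma> a i)"
      by (simp add: T_def inner_sum_left) (simp add: inner_commute mult.commute)
    also have "\<dots> = \<gamma> a v"
      using linear_eq_sum_Basis[of "\<gamma> a" v] bil by (simp add: bilinear_def)
    finally show ?thesis .
  qed
  have "linear T"
    by (rule linearI; rule vector_eq_rdot[THEN iffD1])
      (auto simp: T inner_add_left bilinear_ladd[OF bil] bilinear_lmul[OF bil])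
  moreover have "inj T"
    by (rule injI) (metis T posdef_form_eqI[OF assms(1)])
  ultimately have "surj T" using linear_injective_imp_surjective by blast
  then obtain a where a: "(\<Sum>i\<in>Basis. b i *\<^sub>R i) = T a" by (metis surjD)
  have "\<gamma> a v = b v" for v
  proof -
    have "\<gamma> a v = (\<Sum>i\<in>Basis. b i *\<^sub>R i) \<bullet> v" by (simp add: a T)
    also have "\<dots> = (\<Sum>i\<in>Basis. (v \<bullet> i) *\<^sub>R b i)"
      by (simp add: inner_sum_left) (simp add: inner_commute mult.commute)
    also have "\<dots> = b v" using linear_eq_sum_Basis[OF assms(2), of v] by simp
    finally show ?thesis .
  qed
  then have "\<forall>v. \<gamma> (form_solve \<gamma> b) v = b v"
    unfolding form_solve_def by (intro someI_ex[of "\<lambda>a. \<forall>v. \<gamma> a v = b v"]) blast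
  then show ?thesis by blast
qed

text \<open>The constants are the extreme values of \<open>g x u u\<close> on the compact product of
  \<open>K\<close> with the unit sphere. Joint continuity there comes from the expansion in basis
  entries, since only continuity for fixed \<open>u\<close> and \<open>v\<close> is assumed.\<close>

lemma compact_form_bounds:
  fixes g :: "'x::topological_space \<Rightarrow> 'e::euclidean_space \<Rightarrow> 'e \<Rightarrow> real"
  assumes "compact K" "\<And>x. x \<in> K \<Longrightarrow> posdef_form (g x)"
    and "\<And>u v. continuous_on K (\<lambda>x. g x u v)"
  shows "\<exists>m>0. \<exists>M>0. \<forall>x\<in>K. \<forall>u. m * (norm u)\<^sup>2 \<le> g x u u \<and> g x u u \<le> M * (norm u)\<^sup>2"
proof (cases "K = {}")
  case True
  then show ?thesis using zero_less_one[where 'a = real] by blast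
next
  case False
  define S where "S = K \<times> sphere (0::'e) 1"
  define q where "q = (\<lambda>z. g (fst z) (snd z) (snd z))"
  have "compact S" "S \<noteq> {}" using assms(1) False by (auto simp: S_def compact_Times)
  have c1: "continuous_on S (\<lambda>z. \<Sum>i\<in>Basis. \<Sum>j\<in>Basis. (snd z \<bullet> i) * (snd z \<bullet> j) * g (fst z) i j)"
    by (intro continuous_intros continuous_on_compose2[OF assms(3)]) (auto simp: S_def)
  have c2: "q z = (\<Sum>i\<in>Basis. \<Sum>j\<in>Basis. (snd z \<bullet> i) * (snd z \<bullet> j) * g (fst z) i j)" if "z \<in> S" for z
    unfolding q_def by (rule bilinear_eq_sum_Basis)
      (use assms(2) that in \<open>auto simp: S_def posdef_form_def\<close>)
  have "continuous_on S q" by (rule continuous_on_eq[OF c1]) (simp only: c2)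
  obtain a where a: "a \<in> S" "\<And>z. z \<in> S \<Longrightarrow> q a \<le> q z"
    using continuous_attains_inf[OF \<open>compact S\<close> \<open>S \<noteq> {}\<close> \<open>continuous_on S q\<close>] by blast
  obtain b where b: "b \<in> S" "\<And>z. z \<in> S \<Longrightarrow> q z \<le> q b"
    using continuous_attains_sup[OF \<open>compact S\<close> \<open>S \<noteq> {}\<close> \<open>continuous_on S q\<close>] by blast
  have "snd a \<noteq> 0" "fst a \<in> K" using a(1) by (auto simp: S_def)
  then have "q a > 0" using assms(2) by (auto simp: q_def posdef_form_def)
  then have "q b > 0" using b(2)[OF a(1)] by linarith
  have "q a * (norm u)\<^sup>2 \<le> g x u u \<and> g x u u \<le> q b * (norm u)\<^sup>2" if "x \<in> K" for x u
  proof (cases "u = 0")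
    case True
    then show ?thesis using assms(2)[OF that] by (simp add: posdef_form_def bilinear_lzero)
  next
    case False
    have bil: "bilinear (g x)" using assms(2)[OF that] by (simp add: posdef_form_def)
    define w where "w = u /\<^sub>R norm u"
    have z: "(x, w) \<in> S" using that False by (simp add: S_def w_def)
    have w: "norm u *\<^sub>R w = u" using False by (simp add: w_def)
    have "g x u u = g x (norm u *\<^sub>R w) (norm u *\<^sub>R w)" by (simp only: w)
    also have "\<dots> = q (x, w) * (norm u)\<^sup>2"
      by (simp only: bilinear_lmul[OF bil] bilinear_rmul[OF bil]) (simp add: q_def power2_eq_square)
    finally show ?thesis using a(2)[OF z] b(2)[OF z] by (simp add: mult_right_mono)
  qed
  then show ?thesis using \<open>q a > 0\<close> \<open>q b > 0\<close> by blast
qed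

section \<open>Regular dependence of solutions on the form and the right-hand side\<close>

text \<open>An energy estimate in place of an inverse matrix: testing the equation for
  \<open>d z\<close> with \<open>v = d z\<close> bounds \<open>norm (d z)\<close> by the entries of
  \<open>r z\<close>, because the coercivity of the limit form \<open>\<beta>\<close> is inherited
  by nearby forms. It serves both for continuity and for difference quotients of solutions.\<close>

lemma tendsto_zero_if_form_solution:
  fixes \<beta> :: "'e::euclidean_space \<Rightarrow> 'e \<Rightarrow> real"
  assumes pd: "posdef_form \<beta>" and bil: "\<forall>\<^sub>F z in F. bilinear (\<gamma> z)"
    and lim: "\<And>i j. i \<in> Basis \<Longrightarrow> j \<in> Basis \<Longrightarrow> ((\<lambda>z. \<gamma> z i j) \<longlongrightarrow> \<beta> i j) F"
    and r: "\<And>i. i \<in> Basis \<Longrightarrow> ((\<lambda>z. r z i) \<longlongrightarrow> 0) F"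
    and d: "\<forall>\<^sub>F z in F. \<forall>v. \<gamma> z (d z) v = r z v"
  shows "(d \<longlongrightarrow> (0::'e)) F"
proof -
  \<comment> \<open>A one-point parameter set turns the compactness bound into coercivity of the
    single form \<open>\<beta>\<close>.\<close>
  obtain m where m: "m > 0" "\<And>u. m * (norm u)\<^sup>2 \<le> \<beta> u u"
    using compact_form_bounds[of "{0::real}" "\<lambda>_. \<beta>"] pd by (simp add: continuous_on_const) blast
  \<comment> \<open>\<open>E z\<close> measures the distance of the forms entrywise. Once it is
    below \<open>m / 2\<close>, the form \<open>\<gamma> z\<close> keeps the coercivity constant
    \<open>m / 2\<close>, whence the factor \<open>2 / m\<close> below.\<close>
  define E where "E = (\<lambda>z. \<Sum>i\<in>Basis. \<Sum>j\<in>Basis. \<bar>\<beta> i j - \<gamma> z i j\<bar>)"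
  have "(E \<longlongrightarrow> (\<Sum>i\<in>Basis. \<Sum>j\<in>(Basis::'e set). \<bar>\<beta> i j - \<beta> i j\<bar>)) F"
    unfolding E_def by (intro tendsto_intros lim)
  then have E: "\<forall>\<^sub>F z in F. E z < m / 2" using m(1) by (intro order_tendstoD(2)) auto
  have "((\<lambda>z. (2 / m) * (\<Sum>i\<in>Basis. \<bar>r z i\<bar>)) \<longlongrightarrow> (2 / m) * (\<Sum>i\<in>(Basis::'e set). \<bar>0\<bar>)) F"
    by (intro tendsto_intros r)
  then have R: "((\<lambda>z. (2 / m) * (\<Sum>i\<in>Basis. \<bar>r z i\<bar>)) \<longlongrightarrow> 0) F" by simp
  have "\<forall>\<^sub>F z in F. norm (d z) \<le> (2 / m) * (\<Sum>i\<in>Basis. \<bar>r z i\<bar>)"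
    using bil d E
  proof eventually_elim
    case (elim z)
    let ?u = "d z"
    have bil0: "bilinear \<beta>" using pd by (simp add: posdef_form_def)
    have ni: "\<bar>?u \<bullet> i\<bar> \<le> norm ?u" if "i \<in> Basis" for i using that by (rule Basis_le_norm)
    have "\<beta> ?u ?u - \<gamma> z ?u ?u = (\<Sum>i\<in>Basis. \<Sum>j\<in>Basis. (?u \<bullet> i) * (?u \<bullet> j) * (\<beta> i j - \<gamma> z i j))"
      by (subst bilinear_eq_sum_Basis[OF bil0], subst bilinear_eq_sum_Basis[OF elim(1)])
        (simp add: sum_subtractf algebra_simps)
    also have "\<dots> \<le> (\<Sum>i\<in>Basis. \<Sum>j\<in>Basis. norm ?u * norm ?u * \<bar>\<beta> i j - \<gamma> z i j\<bar>)"
    proof (intro sum_mono)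
      fix i j :: 'e assume "i \<in> Basis" "j \<in> Basis"
      have "(?u \<bullet> i) * (?u \<bullet> j) * (\<beta> i j - \<gamma> z i j) \<le> \<bar>?u \<bullet> i\<bar> * \<bar>?u \<bullet> j\<bar> * \<bar>\<beta> i j - \<gamma> z i j\<bar>"
        by (metis abs_ge_self abs_mult)
      also have "\<dots> \<le> norm ?u * norm ?u * \<bar>\<beta> i j - \<gamma> z i j\<bar>"
        by (intro mult_mono ni) (auto simp: \<open>i \<in> Basis\<close> \<open>j \<in> Basis\<close>)
      finally show "(?u \<bullet> i) * (?u \<bullet> j) * (\<beta> i j - \<gamma> z i j) \<le> norm ?u * norm ?u * \<bar>\<beta> i j - \<gamma> z i j\<bar>" .
    qed
    also have "\<dots> = (norm ?u)\<^sup>2 * E z" by (simp add: E_def sum_distrib_left power2_eq_square)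
    also have "\<dots> \<le> (norm ?u)\<^sup>2 * (m / 2)" using elim(3) by (intro mult_left_mono) auto
    finally have 1: "(norm ?u)\<^sup>2 * (m / 2) \<le> \<gamma> z ?u ?u" using m(2)[of ?u] by (simp add: algebra_simps)
    have "linear (\<gamma> z ?u)" using elim(1) by (simp add: bilinear_def)
    have "\<gamma> z ?u ?u = (\<Sum>i\<in>Basis. (?u \<bullet> i) * r z i)"
      using linear_eq_sum_Basis[OF \<open>linear (\<gamma> z ?u)\<close>, of ?u] elim(2) by simp
    also have "\<dots> \<le> (\<Sum>i\<in>Basis. norm ?u * \<bar>r z i\<bar>)"
    proof (intro sum_mono)
      fix i :: 'e assume "i \<in> Basis"
      have "(?u \<bullet> i) * r z i \<le> \<bar>?u \<bullet> i\<bar> * \<bar>r z i\<bar>" by (metis abs_ge_self abs_mult)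
      also have "\<dots> \<le> norm ?u * \<bar>r z i\<bar>" using ni[OF \<open>i \<in> Basis\<close>] by (intro mult_right_mono) auto
      finally show "(?u \<bullet> i) * r z i \<le> norm ?u * \<bar>r z i\<bar>" .
    qed
    also have "\<dots> = norm ?u * (\<Sum>i\<in>Basis. \<bar>r z i\<bar>)" by (simp add: sum_distrib_left)
    finally have "norm ?u * (norm ?u * (m / 2)) \<le> norm ?u * (\<Sum>i\<in>Basis. \<bar>r z i\<bar>)"
      using 1 by (simp add: power2_eq_square algebra_simps)
    then have "norm ?u * (m / 2) \<le> (\<Sum>i\<in>Basis. \<bar>r z i\<bar>)"
      by (cases "?u = 0") (auto simp: sum_nonneg)
    then show ?case using m(1) by (simp add: field_simps)
  qed
  then show ?thesis using R by (rule Lim_null_comparison)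
qed

text \<open>The difference \<open>a z - a x\<close> solves the system for \<open>\<gamma> z\<close>
  with right-hand side \<open>b z v - \<gamma> z (a x) v\<close>, which tends to 0.\<close>

lemma continuous_on_form_solution:
  assumes pd: "\<And>z. z \<in> S \<Longrightarrow> posdef_form (\<gamma> z)"
    and g: "\<And>u v. continuous_on S (\<lambda>z. \<gamma> z u v)" and b: "\<And>v. continuous_on S (\<lambda>z. b z v)"
    and a: "\<And>z v. z \<in> S \<Longrightarrow> \<gamma> z (a z) v = b z v"
  shows "continuous_on S a"
  unfolding continuous_on_def
proof
  fix x assume "x \<in> S"
  have lg: "((\<lambda>z. \<gamma> z u v) \<longlongrightarrow> \<gamma> x u v) (at x within S)" for u v
    using g[unfolded continuous_on_def] \<open>x \<in> S\<close> by blast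
  have lb: "((\<lambda>z. b z v) \<longlongrightarrow> b x v) (at x within S)" for v
    using b[unfolded continuous_on_def] \<open>x \<in> S\<close> by blast
  have S: "\<forall>\<^sub>F z in at x within S. z \<in> S" by (simp add: eventually_at_filter)
  have "((\<lambda>z. a z - a x) \<longlongrightarrow> 0) (at x within S)"
  proof (rule tendsto_zero_if_form_solution[where \<beta> = "\<gamma> x" and \<gamma> = \<gamma>
        and r = "\<lambda>z v. b z v - \<gamma> z (a x) v"])
    show "\<forall>\<^sub>F z in at x within S. bilinear (\<gamma> z)"
      using S by eventually_elim (use pd in \<open>auto simp: posdef_form_def\<close>)
    show "((\<lambda>z. b z v - \<gamma> z (a x) v) \<longlongrightarrow> 0) (at x within S)" for v
      using tendsto_diff[OF lb lg, of v "a x" v] a[OF \<open>x \<in> S\<close>] by simp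
    show "\<forall>\<^sub>F z in at x within S. \<forall>v. \<gamma> z (a z - a x) v = b z v - \<gamma> z (a x) v"
      using S by eventually_elim (use pd a in \<open>auto simp: posdef_form_def bilinear_lsub\<close>)
  qed (use lg pd \<open>x \<in> S\<close> in auto)
  then show "(a \<longlongrightarrow> a x) (at x within S)" by (simp add: LIM_zero_cancel)
qed

text \<open>Differentiating the equation shows that each directional derivative of \<open>a\<close>
  solves a system with the same form \<open>\<gamma>\<close> and a right-hand side one order less
  regular, so the induction closes. That the solution \<open>a'\<close> of the differentiated system
  really is the derivative follows by applying the energy estimate to the remainder
  quotient.\<close>

lemma Ck_on_form_solution:
  fixes \<gamma> :: "'d::euclidean_space \<Rightarrow> 'e::euclidean_space \<Rightarrow> 'e \<Rightarrow> real"
  assumes "open S" and pd: "\<And>z. z \<in> S \<Longrightarrow> posdef_form (\<gamma> z)"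
    and "\<And>u v. Ck_on k S (\<lambda>z. \<gamma> z u v)" and "\<And>v. Ck_on k S (\<lambda>z. b z v)"
    and "\<And>z v. z \<in> S \<Longrightarrow> \<gamma> z (a z) v = b z v"
  shows "Ck_on k S a"
  using assms(3-5)
proof (induction k arbitrary: a b)
  case 0
  then show ?case using continuous_on_form_solution[of S \<gamma> b a] pd by simp
next
  case (Suc k)
  have aCk: "Ck_on k S a" using Suc.IH[of b a] Suc.prems Ck_on_Suc_imp by blast
  \<comment> \<open>The right-hand side of the formally differentiated equation, extended linearly
    from basis vectors \<open>j\<close> so that \<open>form_solve\<close> applies to it.\<close>
  define bD where "bD = (\<lambda>x w v. \<Sum>j\<in>Basis. (v \<bullet> j) *
      (fder (\<lambda>z. b z j) x w - (\<Sum>i\<in>Basis. (a x \<bullet> i) * fder (\<lambda>z. \<gamma> z i j) x w)))"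
  have bD_lin: "linear (bD x w)" for x w
    by (rule linearI) (auto simp: bD_def inner_add_left sum.distrib sum_subtractf algebra_simps sum_distrib_left)
  have bD_j: "bD x w j = fder (\<lambda>z. b z j) x w - (\<Sum>i\<in>Basis. (a x \<bullet> i) * fder (\<lambda>z. \<gamma> z i j) x w)"
    if "j \<in> Basis" for x w j
    using that by (simp add: bD_def inner_Basis if_distrib[of "\<lambda>t. t * _"] cong: if_cong)
  define a' where "a' = (\<lambda>x w. form_solve (\<gamma> x) (bD x w))"
  have a': "\<gamma> x (a' x w) v = bD x w v" if "x \<in> S" for x w v
    unfolding a'_def by (rule form_solve[OF pd[OF that] bD_lin])
  show ?case
  proof (rule Ck_on_SucI[OF assms(1), where f' = a'])
    fix x assume x: "x \<in> S"
    have bil: "bilinear (\<gamma> z)" if "z \<in> S" for z using pd[OF that] by (simp add: posdef_form_def)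
    note gd = Ck_on_SucD(2)[OF Suc.prems(1) x]
    note bd = Ck_on_SucD(2)[OF Suc.prems(2) x]
    have bD_w: "linear (\<lambda>w. bD x w v)" for v
    proof -
      have "linear (fder (\<lambda>z. b z j) x)" "linear (fder (\<lambda>z. \<gamma> z i j) x)" for i j
        using gd bd has_derivative_linear by blast+
      then show ?thesis
        by (intro linearI) (auto simp: bD_def linear_add linear_scale sum.distrib algebra_simps 
            sum_distrib_left sum_subtractf)
    qed
    have lin: "linear (a' x)"
      by (rule linearI; rule posdef_form_eqI[OF pd[OF x]])
        (auto simp: a'[OF x] bilinear_ladd[OF bil[OF x]] bilinear_lmul[OF bil[OF x]] 
          linear_add[OF bD_w] linear_scale[OF bD_w])
    have gcont: "((\<lambda>z. \<gamma> z u v) \<longlongrightarrow> \<gamma> x u v) (at x)" for u v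
      using has_derivative_continuous[OF gd[of u v]] by (simp add: isCont_def)
    have inS: "\<forall>\<^sub>F z in at x. z \<in> S" using \<open>open S\<close> x by (rule eventually_at_in_open')
    define N where "N = (\<lambda>z. inverse (norm (z - x)))"
    define r where "r = (\<lambda>z v. N z * (b z v - \<gamma> z (a x) v - \<gamma> z (a' x (z - x)) v))"
    have "((\<lambda>z. N z *\<^sub>R (a z - a x - a' x (z - x))) \<longlongrightarrow> 0) (at x)"
    proof (rule tendsto_zero_if_form_solution[where \<beta> = "\<gamma> x" and \<gamma> = \<gamma> and r = r])
      show "\<forall>\<^sub>F z in at x. bilinear (\<gamma> z)" using inS by eventually_elim (use bil in auto)
      show "\<forall>\<^sub>F z in at x. \<forall>v. \<gamma> z (N z *\<^sub>R (a z - a x - a' x (z - x))) v = r z v"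
        using inS by eventually_elim
          (use bil Suc.prems(3) in \<open>auto simp: r_def bilinear_lmul bilinear_lsub\<close>)
    next
      fix j :: 'e assume j: "j \<in> Basis"
      \<comment> \<open>The error splits into the Taylor remainder of \<open>b\<close>, that of
        \<open>\<gamma>\<close> paired with \<open>a x\<close>, and the cost of having
        \<open>\<gamma> z\<close> instead of \<open>\<gamma> x\<close> in front of
        \<open>a'\<close>. The last is a bounded quotient times a null function.\<close>
      define r1 where "r1 = (\<lambda>z. N z * (b z j - b x j - fder (\<lambda>z. b z j) x (z - x)))"
      define r2 where "r2 = (\<lambda>z i. N z * (\<gamma> z i j - \<gamma> x i j - fder (\<lambda>z. \<gamma> z i j) x (z - x)))"
      define r3 where "r3 = (\<lambda>z i. (N z * (a' x (z - x) \<bullet> i)) * (\<gamma> x i j - \<gamma> z i j))"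
      have r1: "(r1 \<longlongrightarrow> 0) (at x)"
        using bd[of j] by (simp add: r1_def N_def has_derivative_at_within)
      have r2: "((\<lambda>z. r2 z i) \<longlongrightarrow> 0) (at x)" for i
        using gd[of i j] by (simp add: r2_def N_def has_derivative_at_within)
      have r3: "((\<lambda>z. r3 z i) \<longlongrightarrow> 0) (at x)" if i: "i \<in> Basis" for i
      proof -
        obtain B where B: "B > 0" "\<And>w. norm (a' x w) \<le> B * norm w"
          using linear_bounded_pos[OF lin] by blast
        have "\<forall>\<^sub>F z in at x. norm (N z * (a' x (z - x) \<bullet> i)) \<le> B"
        proof (rule eventuallyI)
          fix z
          have "\<bar>a' x (z - x) \<bullet> i\<bar> \<le> B * norm (z - x)"
            using Basis_le_norm[OF i] B(2) order_trans by blast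
          then show "norm (N z * (a' x (z - x) \<bullet> i)) \<le> B"
            using B(1) by (cases "z = x") (auto simp: N_def abs_mult divide_simps)
        qed
        moreover have "((\<lambda>z. \<gamma> x i j - \<gamma> z i j) \<longlongrightarrow> 0) (at x)"
          using tendsto_diff[OF tendsto_const gcont, of "\<gamma> x i j" i j] by simp
        ultimately show ?thesis
          unfolding r3_def by (rule lim_null_mult_left_bounded)
      qed
      have "((\<lambda>z. r1 z - (\<Sum>i\<in>Basis. (a x \<bullet> i) * r2 z i) + (\<Sum>i\<in>Basis. r3 z i)) \<longlongrightarrow> 
          0 - (\<Sum>i\<in>Basis. (a x \<bullet> i) * 0) + (\<Sum>i\<in>(Basis::'e set). 0)) (at x)"
        by (intro tendsto_intros r1 r2 r3)
      moreover have "\<forall>\<^sub>F z in at x. r1 z - (\<Sum>i\<in>Basis. (a x \<bullet> i) * r2 z i) + (\<Sum>i\<in>Basis. r3 z i) = r z j"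
        using inS
      proof eventually_elim
        case (elim z)
        have ex: "\<gamma> y u j = (\<Sum>i\<in>Basis. (u \<bullet> i) * \<gamma> y i j)" if "y \<in> S" for y u
          using linear_eq_sum_Basis[of "\<lambda>u. \<gamma> y u j" u] bil[OF that] by (simp add: bilinear_def)
        let ?h = "z - x"
        have "(\<Sum>i\<in>Basis. (a x \<bullet> i) * r2 z i) = 
          N z * (\<gamma> z (a x) j - \<gamma> x (a x) j - (\<Sum>i\<in>Basis. (a x \<bullet> i) * fder (\<lambda>z. \<gamma> z i j) x ?h))"
          unfolding ex[OF elim, of "a x"] ex[OF x, of "a x"] r2_def
          by (simp add: algebra_simps sum_distrib_left sum_subtractf sum.distrib)
        moreover have "(\<Sum>i\<in>Basis. r3 z i) = N z * (\<gamma> x (a' x ?h) j - \<gamma> z (a' x ?h) j)"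
          unfolding ex[OF elim, of "a' x ?h"] ex[OF x, of "a' x ?h"] r3_def
          by (simp add: algebra_simps sum_distrib_left sum_subtractf sum.distrib)
        moreover have "\<gamma> x (a' x ?h) j = fder (\<lambda>z. b z j) x ?h - 
            (\<Sum>i\<in>Basis. (a x \<bullet> i) * fder (\<lambda>z. \<gamma> z i j) x ?h)"
          by (simp add: a'[OF x] bD_j[OF j])
        moreover have "\<gamma> x (a x) j = b x j" by (rule Suc.prems(3)[OF x])
        ultimately show ?case by (simp add: r1_def r_def algebra_simps)
      qed
      ultimately show "((\<lambda>z. r z j) \<longlongrightarrow> 0) (at x)" 
        by (simp add: tendsto_cong)
    qed (use gcont pd[OF x] in auto)
    then show "(a has_derivative a' x) (at x)"
      using lin by (simp add: has_derivative_at_within N_def linear_conv_bounded_linear)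
  next
    fix w
    show "Ck_on k S (\<lambda>x. a' x w)"
    proof (rule Suc.IH[where b = "\<lambda>x v. bD x w v"])
      show "Ck_on k S (\<lambda>z. \<gamma> z u v)" for u v using Suc.prems(1) Ck_on_Suc_imp by blast
      show "Ck_on k S (\<lambda>z. bD z w v)" for v
        unfolding bD_def
        by (intro Ck_on_sum Ck_on_mult Ck_on_minus Ck_on_inner_const Ck_on_const assms(1) aCk
            Ck_on_SucD(3)[OF Suc.prems(1)] Ck_on_SucD(3)[OF Suc.prems(2)])
    qed (rule a')
  qed
qed

section \<open>Second derivatives of isometric maps\<close>

definition metric_on :: "'e::euclidean_space set \<Rightarrow> ('e \<Rightarrow> 'e \<Rightarrow> 'e \<Rightarrow> real) \<Rightarrow> bool" where
  "metric_on S g \<longleftrightarrow> open S \<and> (\<forall>x\<in>S. posdef_form (g x)) \<and> (\<forall>u v. smooth_on S (\<lambda>x. g x u v))"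

lemma metric_onD:
  assumes "metric_on S g"
  shows "open S" and "\<And>x. x \<in> S \<Longrightarrow> posdef_form (g x)" and "\<And>x. x \<in> S \<Longrightarrow> bilinear (g x)"
    and "\<And>k u v. Ck_on k S (\<lambda>x. g x u v)" and "\<And>u v. continuous_on S (\<lambda>x. g x u v)"
  using assms by (auto simp: metric_on_def smooth_on_def posdef_form_def intro: Ck_on_imp_continuous[of 0])

text \<open>In index notation this is \<open>p^a q^b r^c d_a g_bc\<close>: the base point moves in
  direction \<open>p\<close> while \<open>q\<close> and \<open>r\<close> are held constant in
  coordinates. Writing it in basis entries makes its regularity in all arguments immediate.\<close>

definition metric_deriv :: "('e::euclidean_space \<Rightarrow> 'e \<Rightarrow> 'e \<Rightarrow> real) \<Rightarrow> 'e \<Rightarrow> 'e \<Rightarrow> 'e \<Rightarrow> 'e \<Rightarrow> real" where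
  "metric_deriv g x p q r = (\<Sum>b\<in>Basis. \<Sum>c\<in>Basis. \<Sum>a\<in>Basis.
     (q \<bullet> b) * (r \<bullet> c) * ((p \<bullet> a) * fder (\<lambda>y. g y b c) x a))"

lemma metric_has_derivative:
  fixes y q r :: "'d::real_normed_vector \<Rightarrow> 'e::euclidean_space"
  assumes "metric_on T h" and yT: "y x \<in> T" and dy: "(y has_derivative y') (at x)"
    and dq: "(q has_derivative q') (at x)" and dr: "(r has_derivative r') (at x)"
  shows "((\<lambda>z. h (y z) (q z) (r z)) has_derivative
           (\<lambda>v. metric_deriv h (y x) (y' v) (q x) (r x) + h (y x) (q' v) (r x) + h (y x) (q x) (r' v))) (at x)"
proof -
  note T = metric_onD[OF assms(1)]
  have dh: "((\<lambda>z. h (y z) b c) has_derivative (\<lambda>v. fder (\<lambda>y. h y b c) (y x) (y' v))) (at x)" for b c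
    by (rule has_derivative_compose[OF dy Ck_on_SucD(2)[OF T(4) yT]])
  have lin: "fder (\<lambda>y. h y b c) (y x) v = (\<Sum>a\<in>Basis. (v \<bullet> a) * fder (\<lambda>y. h y b c) (y x) a)" for b c v
    using linear_eq_sum_Basis[OF has_derivative_linear[OF Ck_on_SucD(2)[OF T(4) yT]], of b c v] by simp
  have "((\<lambda>z. \<Sum>b\<in>Basis. \<Sum>c\<in>Basis. ((q z \<bullet> b) * (r z \<bullet> c)) * h (y z) b c) has_derivative
      (\<lambda>v. \<Sum>b\<in>Basis. \<Sum>c\<in>Basis. ((q x \<bullet> b) * (r x \<bullet> c)) * fder (\<lambda>y. h y b c) (y x) (y' v) +
          ((q x \<bullet> b) * (r' v \<bullet> c) + (q' v \<bullet> b) * (r x \<bullet> c)) * h (y x) b c)) (at x)"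
    by (intro has_derivative_sum has_derivative_mult dh has_derivative_inner_left dq dr)
  moreover have "(\<Sum>b\<in>Basis. \<Sum>c\<in>Basis. ((q x \<bullet> b) * (r x \<bullet> c)) * fder (\<lambda>y. h y b c) (y x) (y' v) +
          ((q x \<bullet> b) * (r' v \<bullet> c) + (q' v \<bullet> b) * (r x \<bullet> c)) * h (y x) b c)
     = metric_deriv h (y x) (y' v) (q x) (r x) + h (y x) (q' v) (r x) + h (y x) (q x) (r' v)" for v
    unfolding metric_deriv_def bilinear_eq_sum_Basis[OF T(3)[OF yT], of "q' v" "r x"]
      bilinear_eq_sum_Basis[OF T(3)[OF yT], of "q x" "r' v"]
    by (subst lin) (simp add: sum.distrib sum_distrib_left algebra_simps)
  ultimately have D: "((\<lambda>z. \<Sum>b\<in>Basis. \<Sum>c\<in>Basis. (q z \<bullet> b) * (r z \<bullet> c) * h (y z) b c) has_derivative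
      (\<lambda>v. metric_deriv h (y x) (y' v) (q x) (r x) + h (y x) (q' v) (r x) + h (y x) (q x) (r' v))) (at x)" by simp
  have "(y \<longlongrightarrow> y x) (at x)" using has_derivative_continuous[OF dy] by (simp add: isCont_def)
  then have ev: "\<forall>\<^sub>F z in at x. y z \<in> T" using topological_tendstoD T(1) yT by blast
  have eq: "(\<Sum>b\<in>Basis. \<Sum>c\<in>Basis. (q z \<bullet> b) * (r z \<bullet> c) * h (y z) b c) = h (y z) (q z) (r z)"
    if "y z \<in> T" for z
    using bilinear_eq_sum_Basis[OF T(3)[OF that], of "q z" "r z"] by simp
  show ?thesis
    by (rule has_derivative_transform_eventually[OF D]) (use ev eq yT in \<open>auto elim: eventually_mono\<close>)
qed

lemma metric_tendsto:
  assumes "metric_on T h" "y0 \<in> T" "(y \<longlongrightarrow> y0) F" "(q \<longlongrightarrow> q0) F" "(r \<longlongrightarrow> r0) F"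
  shows "((\<lambda>z. h (y z) (q z) (r z)) \<longlongrightarrow> h y0 q0 r0) F"
proof -
  note T = metric_onD[OF assms(1)]
  have h: "((\<lambda>z. h (y z) b c) \<longlongrightarrow> h y0 b c) F" for b c
  proof -
    have "isCont (\<lambda>y. h y b c) y0" using T(1,5) assms(2) continuous_on_eq_continuous_at by blast
    then show ?thesis using assms(3) isCont_tendsto_compose by blast
  qed
  have "((\<lambda>z. \<Sum>b\<in>Basis. \<Sum>c\<in>Basis. (q z \<bullet> b) * (r z \<bullet> c) * h (y z) b c) \<longlongrightarrow>
     (\<Sum>b\<in>Basis. \<Sum>c\<in>Basis. (q0 \<bullet> b) * (r0 \<bullet> c) * h y0 b c)) F"
    by (intro tendsto_intros h assms)
  moreover have "\<forall>\<^sub>F z in F. (\<Sum>b\<in>Basis. \<Sum>c\<in>Basis. (q z \<bullet> b) * (r z \<bullet> c) * h (y z) b c) = h (y z) (q z) (r z)"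
    using topological_tendstoD[OF assms(3) T(1) assms(2)]
    by eventually_elim (rule bilinear_eq_sum_Basis[OF T(3), symmetric])
  ultimately show ?thesis
    unfolding bilinear_eq_sum_Basis[OF T(3)[OF assms(2)], of q0 r0] by (rule Lim_transform_eventually)
qed

lemma metric_bounds:
  assumes "metric_on S g" "compact K" "K \<subseteq> S"
  shows "\<exists>m>0. \<exists>M>0. \<forall>x\<in>K. \<forall>u. m * (norm u)\<^sup>2 \<le> g x u u \<and> g x u u \<le> M * (norm u)\<^sup>2"
proof (rule compact_form_bounds[where g = g, OF assms(2)])
  show "posdef_form (g x)" if "x \<in> K" for x using metric_onD(2)[OF assms(1)] assms(3) that by blast
  show "continuous_on K (\<lambda>x. g x u v)" for u v
    by (rule continuous_on_subset[OF metric_onD(5)[OF assms(1)] assms(3)])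
qed

text \<open>With \<open>m\<close> from \<open>h\<close> on \<open>K'\<close> and \<open>M\<close>
  from \<open>g\<close> on \<open>K\<close>, the squared norm of \<open>f u\<close> times
  \<open>m\<close> is at most \<open>h y (f u) (f u) = g x u u\<close>, hence at most
  \<open>M\<close> times that of \<open>u\<close>. So \<open>L = sqrt (M / m)\<close> depends on the
  two compact sets only, which is the source of all equicontinuity below.\<close>

lemma isometric_derivative_bounds:
  assumes "metric_on S g" "compact K" "K \<subseteq> S" "metric_on T h" "compact K'" "K' \<subseteq> T"
  shows "\<exists>L>0. \<forall>x\<in>K. \<forall>y\<in>K'. \<forall>f. (\<forall>u v. h y (f u) (f v) = g x u v) \<longrightarrow>
     (\<forall>u. norm (f u) \<le> L * norm u)"
proof -
  obtain M where M: "M > 0" "\<forall>x\<in>K. \<forall>u. g x u u \<le> M * (norm u)\<^sup>2" 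
    using metric_bounds[OF assms(1-3)] by blast
  obtain m where m: "m > 0" "\<forall>y\<in>K'. \<forall>u. m * (norm u)\<^sup>2 \<le> h y u u"
    using metric_bounds[OF assms(4-6)] by blast
  have "norm (f u) \<le> sqrt (M / m) * norm u"
    if "x \<in> K" "y \<in> K'" "\<forall>u v. h y (f u) (f v) = g x u v" for x y f u
  proof -
    have "m * (norm (f u))\<^sup>2 \<le> M * (norm u)\<^sup>2" 
      using M(2) m(2) that by (metis order_trans)
    then have "(norm (f u))\<^sup>2 \<le> M / m * (norm u)\<^sup>2" using m(1) by (simp add: field_simps)
    then have "sqrt ((norm (f u))\<^sup>2) \<le> sqrt (M / m * (norm u)\<^sup>2)" by (rule real_sqrt_le_mono)
    then show ?thesis by (simp only: real_sqrt_mult real_sqrt_abs abs_norm_cancel)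
  qed
  moreover have "sqrt (M / m) > 0" using M(1) m(1) by simp
  ultimately show ?thesis by blast
qed

lemma isometric_linear_surj:
  fixes f :: "'e::euclidean_space \<Rightarrow> 'e"
  assumes "posdef_form \<gamma>" "posdef_form \<beta>" "linear f" "\<And>u v. \<beta> (f u) (f v) = \<gamma> u v"
  shows "surj f"
proof -
  have "inj f"
    unfolding linear_injective_0[OF assms(3)]
  proof (intro allI impI)
    fix u assume "f u = 0"
    then have "\<gamma> u u = 0" 
      using assms(2) assms(4)[of u u] by (simp add: posdef_form_def bilinear_lzero)
    then show "u = 0" using assms(1) by (force simp: posdef_form_def)
  qed
  then show ?thesis using linear_injective_imp_surjective assms(3) by blast
qed

text \<open>Differentiating \<open>h (F x) (F' x u) (F' x v) = g x u v\<close> in direction \<open>w\<close> and permuting the three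
  directions as in the Koszul formula expresses \<open>h (F x) (F'' x w u) (F' x v)\<close> by first derivatives
  only; here \<open>y = F x\<close> and \<open>P = F' x\<close>.  The formula is extended linearly from basis vectors \<open>v\<close>.\<close>

definition koszul_form :: "('e::euclidean_space \<Rightarrow> 'e \<Rightarrow> 'e \<Rightarrow> real) \<Rightarrow> ('e \<Rightarrow> 'e \<Rightarrow> 'e \<Rightarrow> real)
     \<Rightarrow> 'e \<Rightarrow> 'e \<Rightarrow> ('e \<Rightarrow> 'e) \<Rightarrow> 'e \<Rightarrow> 'e \<Rightarrow> 'e \<Rightarrow> real" where
  "koszul_form g h x y P w u v = (\<Sum>k\<in>Basis. (v \<bullet> k) *
     (((metric_deriv g x w u k - metric_deriv h y (P w) (P u) (P k)) + (metric_deriv g x u w k - metric_deriv h y (P u) (P w) (P k))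
       - (metric_deriv g x k w u - metric_deriv h y (P k) (P w) (P u))) / 2))"

lemma koszul_form_linear: "linear (koszul_form g h x y P w u)"
proof -
  have "linear (\<lambda>v. \<Sum>k\<in>Basis. (v \<bullet> k) * c k)" for c :: "'a \<Rightarrow> real"
    by (rule linearI) (simp_all add: inner_add_left distrib_right sum.distrib sum_distrib_left mult.assoc)
  then show ?thesis unfolding koszul_form_def[abs_def] .
qed

text \<open>In terms of Christoffel symbols, for an isometric \<open>P\<close> this is
  \<open>\<Gamma>_g(w,u)\<close> minus the preimage under \<open>P\<close> of
  \<open>\<Gamma>_h(P w, P u)\<close>. Solving with \<open>g x\<close> instead of \<open>h y\<close>
  avoids the inverse of \<open>P\<close>, so that the expression is also usable for a
  \<open>P\<close> that is not invertible.\<close>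

definition koszul_vector :: "('e::euclidean_space \<Rightarrow> 'e \<Rightarrow> 'e \<Rightarrow> real) \<Rightarrow> ('e \<Rightarrow> 'e \<Rightarrow> 'e \<Rightarrow> real)
     \<Rightarrow> 'e \<Rightarrow> 'e \<Rightarrow> ('e \<Rightarrow> 'e) \<Rightarrow> 'e \<Rightarrow> 'e \<Rightarrow> 'e" where
  "koszul_vector g h x y P w u = form_solve (g x) (koszul_form g h x y P w u)"

lemma koszul_vector: "posdef_form (g x) \<Longrightarrow> g x (koszul_vector g h x y P w u) v = koszul_form g h x y P w u v"
  unfolding koszul_vector_def by (rule form_solve[OF _ koszul_form_linear])

lemma second_derivative_isometric:
  fixes F :: "'e::euclidean_space \<Rightarrow> 'e"
  assumes g: "metric_on S g" and h: "metric_on T h" and U: "open U" "U \<subseteq> S" "F ` U \<subseteq> T"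
    and C2: "Ck_on 2 U F" and iso: "\<And>x u v. x \<in> U \<Longrightarrow> h (F x) (fder F x u) (fder F x v) = g x u v"
    and x: "x \<in> U"
  shows "fder (\<lambda>y. fder F y u) x w = fder F x (koszul_vector g h x (F x) (fder F x) w u)"
proof -
  have C2': "Ck_on (Suc (Suc 0)) U F" using C2 by (simp add: numeral_2_eq_2)
  note d1 = Ck_on_SucD(2)[OF C2' x]
  note d2 = Ck_on_SucD(2)[OF Ck_on_SucD(3)[OF C2'] x]
  have xS: "x \<in> S" and FxT: "F x \<in> T" using x U by auto
  define D where "D = (\<lambda>w u. fder (\<lambda>y. fder F y u) x w)"
  define \<beta> where "\<beta> = h (F x)"
  define P where "P = fder F x"
  have \<beta>: "posdef_form \<beta>" unfolding \<beta>_def by (rule metric_onD(2)[OF h FxT])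
  then have bsym: "\<beta> a b = \<beta> b a" for a b by (simp add: posdef_form_def)
  have bilb: "bilinear \<beta>" using \<beta> by (simp add: posdef_form_def)
  have linP: "linear P" unfolding P_def by (rule has_derivative_linear[OF d1])
  have sym: "D w u = D u w" for w u
    unfolding D_def by (rule second_derivative_symmetric[OF U(1) C2 x])
  have T: "metric_deriv g x w u v - metric_deriv h (F x) (P w) (P u) (P v) = \<beta> (D w u) (P v) + \<beta> (D w v) (P u)" for w u v
  proof -
    have D1: "((\<lambda>z. h (F z) (fder F z u) (fder F z v)) has_derivative
        (\<lambda>w. metric_deriv h (F x) (P w) (P u) (P v) + \<beta> (D w u) (P v) + \<beta> (P u) (D w v))) (at x)"
      unfolding P_def \<beta>_def D_def by (rule metric_has_derivative[where y = F and x = x, OF h FxT d1 d2 d2])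
    have "((\<lambda>z. g z u v) has_derivative (\<lambda>w. metric_deriv g x w u v + g x 0 v + g x u 0)) (at x)"
      by (rule metric_has_derivative[where y = "\<lambda>z. z" and x = x, OF g xS]) (auto intro!: derivative_eq_intros)
    then have D2: "((\<lambda>z. g z u v) has_derivative (\<lambda>w. metric_deriv g x w u v)) (at x)"
      using metric_onD(3)[OF g xS] by (simp add: bilinear_lzero bilinear_rzero)
    have "((\<lambda>z. g z u v) has_derivative
        (\<lambda>w. metric_deriv h (F x) (P w) (P u) (P v) + \<beta> (D w u) (P v) + \<beta> (P u) (D w v))) (at x)"
      by (rule has_derivative_transform_within_open[OF D1 U(1) x]) (rule iso)
    from has_derivative_unique[OF D2 this] show ?thesis
      using bsym by (auto dest!: fun_cong[of _ _ w])
  qed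
  have koszul: "\<beta> (D w u) (P v) = koszul_form g h x (F x) P w u v" for v
  proof -
    \<comment> \<open>Of the six terms given by \<open>T\<close>, the symmetry of \<open>D\<close>
      cancels four and leaves \<open>\<beta> (D w u) (P k)\<close> twice.\<close>
    have *: "\<beta> (D w u) (P k) = (((metric_deriv g x w u k - metric_deriv h (F x) (P w) (P u) (P k)) 
        + (metric_deriv g x u w k - metric_deriv h (F x) (P u) (P w) (P k))
        - (metric_deriv g x k w u - metric_deriv h (F x) (P k) (P w) (P u))) / 2)" for k
      unfolding T using sym[of u w] sym[of k w] sym[of k u] bsym by simp
    have "koszul_form g h x (F x) P w u v = (\<Sum>k\<in>Basis. (v \<bullet> k) * \<beta> (D w u) (P k))"
      by (simp only: koszul_form_def *)
    also have "\<dots> = \<beta> (D w u) (P v)"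
    proof -
      have "linear (\<lambda>v. \<beta> (D w u) (P v))"
        using linear_compose[OF linP, of "\<beta> (D w u)"] bilb by (simp add: bilinear_def o_def)
      from linear_eq_sum_Basis[OF this, of v] show ?thesis by simp
    qed
    finally show ?thesis ..
  qed
  have gx: "posdef_form (g x)" by (rule metric_onD(2)[OF g xS])
  have isoP: "\<beta> (P a) (P b) = g x a b" for a b using iso[OF x] by (simp add: \<beta>_def P_def)
  \<comment> \<open>Surjectivity makes the vectors \<open>P v\<close> exhaust all test vectors, so
    the Koszul identity determines \<open>D w u\<close>.\<close>
  have "surj P" by (rule isometric_linear_surj[OF gx \<beta> linP isoP])
  have "D w u = P (koszul_vector g h x (F x) P w u)"
  proof (rule posdef_form_eqI[OF \<beta>])
    fix v
    obtain v' where "v = P v'" using \<open>surj P\<close> by (metis surjD)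
    then show "\<beta> (D w u) v = \<beta> (P (koszul_vector g h x (F x) P w u)) v"
      using koszul isoP koszul_vector[where g = g and x = x, OF gx] by simp
  qed
  then show ?thesis by (simp add: D_def P_def)
qed

section \<open>Regularity of the Koszul vector\<close>

lemma metric_deriv_continuous:
  assumes h: "metric_on T h" and y: "continuous_on Z y" "y ` Z \<subseteq> T"
    and "continuous_on Z p" "continuous_on Z q" "continuous_on Z r"
  shows "continuous_on Z (\<lambda>z. metric_deriv h (y z) (p z) (q z) (r z))"
proof -
  have "continuous_on Z (\<lambda>z. fder (\<lambda>y. h y b c) (y z) a)" for a b c
    using continuous_on_compose2[OF Ck_on_imp_continuous[OF Ck_on_SucD(3)[OF metric_onD(4)[OF h]]] y] .
  then show ?thesis unfolding metric_deriv_def by (intro continuous_intros assms)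
qed

lemma metric_deriv_Ck:
  fixes y :: "'d::euclidean_space \<Rightarrow> 'e::euclidean_space"
  assumes h: "metric_on T h" and "open Z" and y: "Ck_on k Z y" "y ` Z \<subseteq> T"
    and "Ck_on k Z p" "Ck_on k Z q" "Ck_on k Z r"
  shows "Ck_on k Z (\<lambda>z. metric_deriv h (y z) (p z) (q z) (r z))"
proof -
  have "Ck_on k Z (\<lambda>z. fder (\<lambda>y. h y b c) (y z) a)" for a b c
    by (rule Ck_on_compose[OF \<open>open Z\<close> metric_onD(1)[OF h] y(2) 
          Ck_on_SucD(3)[OF metric_onD(4)[OF h]] y(1)])
  then show ?thesis unfolding metric_deriv_def by (intro Ck_on_sum Ck_on_mult Ck_on_inner_const assms)
qed

text \<open>Point, value and derivative vary independently here: the lemma is meant for the compact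
  set of all admissible triples, not only for those that come from a map.\<close>

lemma koszul_vector_continuous:
  assumes g: "metric_on S g" and h: "metric_on T h"
    and x: "continuous_on Z x" "x ` Z \<subseteq> S" and y: "continuous_on Z y" "y ` Z \<subseteq> T"
    and P: "\<And>v. continuous_on Z (\<lambda>z. P z v)"
  shows "continuous_on Z (\<lambda>z. koszul_vector g h (x z) (y z) (P z) w u)"
proof (rule continuous_on_form_solution[where \<gamma> = "\<lambda>z. g (x z)"
      and b = "\<lambda>z. koszul_form g h (x z) (y z) (P z) w u"])
  show pd: "posdef_form (g (x z))" if "z \<in> Z" for z using metric_onD(2)[OF g] x(2) that by blast
  show "continuous_on Z (\<lambda>z. g (x z) u v)" for u v
    by (rule continuous_on_compose2[OF metric_onD(5)[OF g] x])
  show "continuous_on Z (\<lambda>z. koszul_form g h (x z) (y z) (P z) w u v)" for v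
    unfolding koszul_form_def
    by (intro continuous_intros metric_deriv_continuous[OF g x] metric_deriv_continuous[OF h y] P) auto
  show "g (x z) (koszul_vector g h (x z) (y z) (P z) w u) v = koszul_form g h (x z) (y z) (P z) w u v"
    if "z \<in> Z" for z v by (rule koszul_vector[where g = g and x = "x z", OF pd[OF that]])
qed

lemma koszul_vector_Ck:
  fixes y :: "'e::euclidean_space \<Rightarrow> 'e"
  assumes g: "metric_on S g" and h: "metric_on T h"
    and Z: "open Z" "Z \<subseteq> S" and y: "Ck_on k Z y" "y ` Z \<subseteq> T"
    and P: "\<And>v. Ck_on k Z (\<lambda>z. P z v)"
  shows "Ck_on k Z (\<lambda>z. koszul_vector g h z (y z) (P z) w u)"
proof (rule Ck_on_form_solution[where \<gamma> = g and b = "\<lambda>z. koszul_form g h z (y z) (P z) w u"])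
  show pd: "posdef_form (g z)" if "z \<in> Z" for z using metric_onD(2)[OF g] Z(2) that by blast
  show "Ck_on k Z (\<lambda>z. g z u v)" for u v
    by (rule Ck_on_subset[OF metric_onD(4)[OF g] Z(2)])
  have id: "Ck_on k Z (\<lambda>z. z)" by (rule Ck_on_bounded_linear[OF bounded_linear_ident Z(1)])
  have "(\<lambda>z. z) ` Z \<subseteq> S" using Z(2) by simp
  then show "Ck_on k Z (\<lambda>z. koszul_form g h z (y z) (P z) w u v)" for v
    unfolding koszul_form_def divide_inverse
    by (intro Ck_on_sum Ck_on_mult Ck_on_minus Ck_on_add Ck_on_const metric_deriv_Ck[OF g Z(1) id] 
        metric_deriv_Ck[OF h Z(1) y] P Z(1))
  show "g z (koszul_vector g h z (y z) (P z) w u) v = koszul_form g h z (y z) (P z) w u v"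
    if "z \<in> Z" for z v by (rule koszul_vector[where g = g and x = z, OF pd[OF that]])
qed (rule Z(1))

section \<open>Limits of isometric maps in coordinates\<close>

text \<open>If \<open>F\<close> and \<open>F'\<close> are of class \<open>C\<^sup>k\<close>, then so is the right-hand side of the equation for \<open>F''\<close>.\<close>

lemma smooth_on_isometric_bootstrap:
  fixes F :: "'e::euclidean_space \<Rightarrow> 'e"
  assumes g: "metric_on S g" and h: "metric_on T h"
    and B: "open B" "B \<subseteq> S" "F ` B \<subseteq> T"
    and dF: "\<And>x. x \<in> B \<Longrightarrow> (F has_derivative P x) (at x)"
    and dP: "\<And>x u. x \<in> B \<Longrightarrow> u \<in> Basis \<Longrightarrow> ((\<lambda>x. P x u) has_derivative
       (\<lambda>w. \<Sum>i\<in>Basis. (w \<bullet> i) *\<^sub>R P x (koszul_vector g h x (F x) (P x) i u))) (at x)"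
  shows "smooth_on B F"
proof -
  have Pl: "P x u = (\<Sum>j\<in>Basis. (u \<bullet> j) *\<^sub>R P x j)" if "x \<in> B" for x u
    by (rule linear_eq_sum_Basis[OF has_derivative_linear[OF dF[OF that]]])
  have extend: "Ck_on k B (\<lambda>x. P x u)" if "\<And>j. j \<in> Basis \<Longrightarrow> Ck_on k B (\<lambda>x. P x j)" for k u
  proof (rule Ck_on_cong[OF B(1)])
    show "Ck_on k B (\<lambda>x. \<Sum>j\<in>Basis. (u \<bullet> j) *\<^sub>R P x j)"
      by (intro Ck_on_sum Ck_on_scaleR Ck_on_const B(1) that)
  qed (rule Pl[symmetric])
  have "Ck_on k B F \<and> (\<forall>u. Ck_on k B (\<lambda>x. P x u))" for k
  proof (induction k)
    case 0
    have "continuous_on B F" using dF B(1)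
      by (meson continuous_at_imp_continuous_on has_derivative_continuous)
    moreover have "Ck_on 0 B (\<lambda>x. P x j)" if "j \<in> Basis" for j
      unfolding Ck_on.simps using dP[OF _ that] 
      by (meson continuous_at_imp_continuous_on has_derivative_continuous)
    ultimately show ?case using extend[of 0] by (metis Ck_on.simps(1))
  next
    case (Suc k)
    then have Fk: "Ck_on k B F" and Pk: "\<And>u. Ck_on k B (\<lambda>x. P x u)" by auto
    have "Ck_on (Suc k) B F" by (rule Ck_on_SucI[OF B(1) dF Pk])
    moreover have "Ck_on (Suc k) B (\<lambda>x. P x j)" if j: "j \<in> Basis" for j
    proof (rule Ck_on_SucI[OF B(1) dP[OF _ j]])
      fix v
      have kv: "Ck_on k B (\<lambda>x. koszul_vector g h x (F x) (P x) i j)" for i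
        by (rule koszul_vector_Ck[OF g h B(1,2) Fk B(3) Pk])
      have "Ck_on k B (\<lambda>x. P x (koszul_vector g h x (F x) (P x) i j))" for i
      proof (rule Ck_on_cong[OF B(1)])
        show "Ck_on k B (\<lambda>x. \<Sum>l\<in>Basis. (koszul_vector g h x (F x) (P x) i j \<bullet> l) *\<^sub>R P x l)"
          by (intro Ck_on_sum Ck_on_scaleR Ck_on_inner_const kv Pk B(1))
      qed (rule Pl[symmetric])
      then show "Ck_on k B (\<lambda>x. \<Sum>i\<in>Basis. (v \<bullet> i) *\<^sub>R P x (koszul_vector g h x (F x) (P x) i j))"
        by (intro Ck_on_sum Ck_on_scaleR Ck_on_const B(1))
    qed
    ultimately show ?case using extend[of "Suc k"] by blast
  qed
  then show ?thesis by (simp add: smooth_on_def)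
qed

text \<open>\<open>has_derivative_sequence\<close> only provides some limit function with derivative
  \<open>g'\<close>; uniqueness of pointwise limits identifies it with the given
  \<open>l\<close>.\<close>

lemma has_derivative_uniform_limit:
  fixes f :: "nat \<Rightarrow> 'a::real_normed_vector \<Rightarrow> 'b::banach"
  assumes "convex S" and "\<And>n x. x \<in> S \<Longrightarrow> (f n has_derivative f' n x) (at x within S)"
    and "\<And>e. e > 0 \<Longrightarrow> \<forall>\<^sub>F n in sequentially. \<forall>x\<in>S. \<forall>v. norm (f' n x v - g' x v) \<le> e * norm v"
    and lim: "\<And>x. x \<in> S \<Longrightarrow> (\<lambda>n. f n x) \<longlonglongrightarrow> l x" and x: "x \<in> S"
  shows "(l has_derivative g' x) (at x within S)"
proof -
  obtain k where k: "\<And>x. x \<in> S \<Longrightarrow> (\<lambda>n. f n x) \<longlonglongrightarrow> k x"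
      "\<And>x. x \<in> S \<Longrightarrow> (k has_derivative g' x) (at x within S)"
    using has_derivative_sequence[OF assms(1-3) x lim[OF x]] by blast
  have "k y = l y" if "y \<in> S" for y using k(1) lim that LIMSEQ_unique by blast
  then show ?thesis using k(2)[OF x] x has_derivative_transform by metis
qed

text \<open>Being isometric bounds the first derivatives, and through the Koszul formula the second ones, so
  Arzela-Ascoli applies to the first derivatives of the sequence.\<close>

lemma isometric_limit:
  fixes F :: "nat \<Rightarrow> 'e::euclidean_space \<Rightarrow> 'e"
  assumes g: "metric_on S g" and h: "metric_on T h" and r: "r > 0"
    and KS: "cball x0 r \<subseteq> S" and K': "compact K'" "K' \<subseteq> T"
    and U: "\<And>n. open (U n)" "\<And>n. cball x0 r \<subseteq> U n" "\<And>n. U n \<subseteq> S"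
    and F: "\<And>n. smooth_on (U n) (F n)" "\<And>n. F n ` U n \<subseteq> T" "\<And>n. F n ` cball x0 r \<subseteq> K'"
    and iso: "\<And>n x u v. x \<in> U n \<Longrightarrow> h (F n x) (fder (F n) x u) (fder (F n) x v) = g x u v"
    and lim: "\<And>x. x \<in> cball x0 r \<Longrightarrow> (\<lambda>n. F n x) \<longlonglongrightarrow> Fl x"
  shows "smooth_on (ball x0 r) Fl"
    and "\<And>x u v. x \<in> ball x0 r \<Longrightarrow> h (Fl x) (fder Fl x u) (fder Fl x v) = g x u v"
proof -
  define K where "K = cball x0 r"
  have K: "compact K" "convex K" "K \<subseteq> S" "\<And>n. K \<subseteq> U n" using KS U(2) by (auto simp: K_def)
  have FK: "F n x \<in> K'" if "x \<in> K" for n x using F(3) that unfolding K_def by blast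
  have Ck: "Ck_on k (U n) (F n)" for n k using F(1) by (simp add: smooth_on_def)
  have d1: "(F n has_derivative fder (F n) x) (at x)" if "x \<in> K" for n x
    using Ck_on_SucD(2)[OF Ck] K(4) that by blast
  have d2: "((\<lambda>z. fder (F n) z u) has_derivative fder (\<lambda>z. fder (F n) z u) x) (at x)" if "x \<in> K" for n x u
    using Ck_on_SucD(2)[OF Ck_on_SucD(3)[OF Ck]] K(4) that by blast
  obtain L where L: "L > 0" "\<forall>x\<in>K. \<forall>y\<in>K'. \<forall>f. (\<forall>u v. h y (f u) (f v) = g x u v) \<longrightarrow>
      (\<forall>u. norm (f u) \<le> L * norm u)"
    using isometric_derivative_bounds[OF g K(1,3) h K'] by blast
  have dL: "norm (fder (F n) x u) \<le> L * norm u" if "x \<in> K" for n x u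
    using L(2) that FK[OF that] iso K(4) by blast
  \<comment> \<open>Derivatives become points of a normed space of linear maps, where Arzela-Ascoli
    can be applied to them and bounded closed balls are compact.\<close>
  define P where "P = (\<lambda>n x. Blinfun (fder (F n) x))"
  have P: "blinfun_apply (P n x) = fder (F n) x" if "x \<in> K" for n x
    unfolding P_def by (rule bounded_linear_Blinfun_apply[OF has_derivative_bounded_linear[OF d1[OF that]]])
  have PL: "norm (P n x) \<le> L" if "x \<in> K" for n x
    by (rule norm_blinfun_bound) (use L(1) dL that P in auto)
  define \<Phi> where "\<Phi> = (\<lambda>i u (z :: 'e \<times> 'e \<times> ('e \<Rightarrow>\<^sub>L 'e)). blinfun_apply (snd (snd z))
      (koszul_vector g h (fst z) (fst (snd z)) (blinfun_apply (snd (snd z))) i u))"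
  \<comment> \<open>The second derivatives of every \<open>F n\<close> on \<open>K\<close> are
    values of the fixed continuous maps \<open>\<Phi> i u\<close> on this compact set, hence bounded
    independently of \<open>n\<close>.\<close>
  define Z where "Z = K \<times> K' \<times> cball (0 :: 'e \<Rightarrow>\<^sub>L 'e) L"
  have Z: "compact Z" unfolding Z_def by (intro compact_Times K K' compact_cball)
  have \<Phi>c: "continuous_on Z (\<Phi> i u)" for i u
    unfolding \<Phi>_def
    by (intro continuous_intros koszul_vector_continuous[OF g h]) (use K(3) K'(2) in \<open>auto simp: Z_def\<close>)
  have inZ: "(x, F n x, P n x) \<in> Z" if "x \<in> K" for n x
    using that FK PL by (simp add: Z_def)
  have "\<exists>b. \<forall>z\<in>Z. norm (\<Phi> i u z) \<le> b" for i u
    using compact_imp_bounded[OF compact_continuous_image[OF \<Phi>c Z]] by (auto simp: bounded_iff)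
  then obtain b where b: "\<And>i u z. z \<in> Z \<Longrightarrow> norm (\<Phi> i u z) \<le> b i u" by metis
  have D2: "((\<lambda>z. fder (F n) z u) has_derivative (\<lambda>w. \<Sum>i\<in>Basis. (w \<bullet> i) *\<^sub>R \<Phi> i u (x, F n x, P n x))) (at x)"
    if "x \<in> K" for n x u
  proof -
    have e1: "fder (\<lambda>z. fder (F n) z u) x i = \<Phi> i u (x, F n x, P n x)" for i
      using second_derivative_isometric[OF g h U(1,3) F(2) Ck iso, of n x u i] K(4) that P[OF that]
      by (auto simp: \<Phi>_def)
    have e2: "fder (\<lambda>z. fder (F n) z u) x w = 
        (\<Sum>i\<in>Basis. (w \<bullet> i) *\<^sub>R fder (\<lambda>z. fder (F n) z u) x i)" for w
      by (rule linear_eq_sum_Basis[OF has_derivative_linear[OF d2[OF that]]])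
    have "fder (\<lambda>z. fder (F n) z u) x = (\<lambda>w. \<Sum>i\<in>Basis. (w \<bullet> i) *\<^sub>R \<Phi> i u (x, F n x, P n x))"
      by (rule ext, subst e2) (simp only: e1)
    then show ?thesis using d2[OF that, of n u] by simp
  qed
  define C where "C = (\<Sum>u\<in>(Basis::'e set). \<Sum>i\<in>(Basis::'e set). b i u)"
  have "K \<noteq> {}" using r by (simp add: K_def)
  then obtain z0 where "z0 \<in> Z" using inZ by blast
  then have b0: "b i u \<ge> 0" for i u using b order_trans[OF norm_ge_zero] by blast
  have PLip: "norm (P n x - P n z) \<le> C * norm (x - z)" if "x \<in> K" "z \<in> K" for n x z
  proof -
    have "norm (P n x - P n z) \<le> (\<Sum>u\<in>Basis. norm ((P n x - P n z) u))"
      by (rule norm_blinfun_euclidean_le)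
    also have "\<dots> \<le> (\<Sum>u\<in>(Basis::'e set). (\<Sum>i\<in>(Basis::'e set). b i u) * norm (x - z))"
    proof (rule sum_mono)
      fix u :: 'e
      have "norm (fder (F n) x u - fder (F n) z u) \<le> (\<Sum>i\<in>(Basis::'e set). b i u) * norm (x - z)"
      proof (rule differentiable_bound[OF K(2) _ _ that])
        fix y assume y: "y \<in> K"
        show "((\<lambda>z. fder (F n) z u) has_derivative 
            (\<lambda>w. \<Sum>i\<in>Basis. (w \<bullet> i) *\<^sub>R \<Phi> i u (y, F n y, P n y))) (at y within K)"
          by (rule has_derivative_at_withinI[OF D2[OF y]])
        show "onorm (\<lambda>w. \<Sum>i\<in>Basis. (w \<bullet> i) *\<^sub>R \<Phi> i u (y, F n y, P n y)) \<le> (\<Sum>i\<in>(Basis::'e set). b i u)"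
        proof (rule onorm_le)
          fix w :: 'e
          have "norm (\<Sum>i\<in>Basis. (w \<bullet> i) *\<^sub>R \<Phi> i u (y, F n y, P n y)) \<le> (\<Sum>i\<in>(Basis::'e set). norm w * b i u)"
            by (rule sum_norm_le) 
              (auto intro!: mult_mono b inZ y simp: Basis_le_norm)
          then show "norm (\<Sum>i\<in>Basis. (w \<bullet> i) *\<^sub>R \<Phi> i u (y, F n y, P n y)) \<le> (\<Sum>i\<in>(Basis::'e set). b i u) * norm w"
            by (simp add: sum_distrib_left mult.commute)
        qed
      qed
      then show "norm ((P n x - P n z) u) \<le> (\<Sum>i\<in>(Basis::'e set). b i u) * norm (x - z)"
        using P that by (simp add: blinfun.diff_left)
    qed
    also have "\<dots> = C * norm (x - z)" by (simp add: C_def sum_distrib_right)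
    finally show ?thesis .
  qed
  have FLip: "norm (F n x - F n z) \<le> L * norm (x - z)" if "x \<in> K" "z \<in> K" for n x z
    by (rule differentiable_bound[OF K(2) has_derivative_at_withinI[OF d1] onorm_le that]) (auto intro: dL)
  have equi: "\<exists>d>0. \<forall>n y. y \<in> K \<and> norm (x - y) < d \<longrightarrow> norm (f n x - f n y) < e"
    if "\<And>n y. y \<in> K \<Longrightarrow> norm (f n x - f n y) \<le> c * norm (x - y)" "c \<ge> 0" "e > 0" 
    for f :: "nat \<Rightarrow> 'e \<Rightarrow> 'f::real_normed_vector" and c e x
  proof (intro exI[of _ "e / (c + 1)"] conjI allI impI)
    show "e / (c + 1) > 0" using that by simp
    fix n y assume y: "y \<in> K \<and> norm (x - y) < e / (c + 1)"
    then have "norm (f n x - f n y) \<le> c * norm (x - y)" using that by blast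
    also have "\<dots> \<le> (c + 1) * norm (x - y)" by (simp add: algebra_simps)
    also have "\<dots> < e" using y that by (simp add: field_simps)
    finally show "norm (f n x - f n y) < e" .
  qed
  obtain M where M: "\<And>y. y \<in> K' \<Longrightarrow> norm y \<le> M" 
    using compact_imp_bounded[OF K'(1)] by (auto simp: bounded_iff)
  \<comment> \<open>The given convergence is only pointwise. The first extraction makes the maps
    converge uniformly, the second, along it, their derivatives; the pointwise limit then identifies
    \<open>f1\<close> with \<open>Fl\<close>.\<close>
  obtain f1 k1 where k1: "continuous_on K f1" "strict_mono (k1 :: nat \<Rightarrow> nat)"
      "\<And>e. 0 < e \<Longrightarrow> \<exists>N. \<forall>n x. n \<ge> N \<and> x \<in> K \<longrightarrow> norm (F (k1 n) x - f1 x) < e"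
    using Arzela_Ascoli[OF K(1), of F M] M FK equi[of F _ L] FLip L(1) by (metis less_imp_le)
  have "C \<ge> 0" unfolding C_def by (intro sum_nonneg b0)
  obtain Pl k2 where k2: "continuous_on K Pl" "strict_mono (k2 :: nat \<Rightarrow> nat)"
      "\<And>e. 0 < e \<Longrightarrow> \<exists>N. \<forall>n x. n \<ge> N \<and> x \<in> K \<longrightarrow> norm (P (k1 (k2 n)) x - Pl x) < e"
    using Arzela_Ascoli[OF K(1), of "\<lambda>n. P (k1 n)" L] PL equi[of "\<lambda>n. P (k1 n)" _ C] PLip \<open>C \<ge> 0\<close> by metis
  define k where "k = (\<lambda>n. k1 (k2 n))"
  have kmono: "strict_mono k" using k1(2) k2(2) by (simp add: k_def strict_mono_def)
  have limk: "(\<lambda>n. F (k n) x) \<longlonglongrightarrow> Fl x" if "x \<in> K" for x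
    using LIMSEQ_subseq_LIMSEQ[OF lim kmono] that by (simp add: o_def K_def)
  have u1: "uniform_limit K (\<lambda>n. F (k1 n)) f1 sequentially"
    unfolding uniform_limit_sequentially_iff dist_norm using k1(3) by meson
  then have "uniform_limit K (\<lambda>n. F (k n)) f1 sequentially"
    unfolding k_def using filterlim_compose[OF _ filterlim_subseq[OF k2(2)]] by auto
  moreover have "f1 x = Fl x" if "x \<in> K" for x
    using tendsto_uniform_limitI[OF calculation that] limk[OF that] LIMSEQ_unique by blast
  ultimately have uF: "uniform_limit K (\<lambda>n. F (k n)) Fl sequentially"
    using uniform_limit_cong'[of K "\<lambda>n. F (k n)" "\<lambda>n. F (k n)" f1 Fl] by simp
  have uP: "uniform_limit K (\<lambda>n. P (k n)) Pl sequentially"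
    unfolding uniform_limit_sequentially_iff dist_norm k_def using k2(3) by meson
  have uZ: "uniform_limit K (\<lambda>n x. (x, F (k n) x, P (k n) x)) (\<lambda>x. (x, Fl x, Pl x)) sequentially"
  proof (rule uniform_limitI)
    fix e :: real assume "e > 0"
    then have "e / 2 > 0" by simp
    then have "\<forall>\<^sub>F n in sequentially. \<forall>x\<in>K. dist (F (k n) x) (Fl x) < e / 2"
      "\<forall>\<^sub>F n in sequentially. \<forall>x\<in>K. dist (P (k n) x) (Pl x) < e / 2"
      using uniform_limitD[OF uF] uniform_limitD[OF uP] by blast+
    then show "\<forall>\<^sub>F n in sequentially. \<forall>x\<in>K. dist (x, F (k n) x, P (k n) x) (x, Fl x, Pl x) < e"
    proof eventually_elim
      case (elim n)
      show ?case
      proof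
        fix x assume "x \<in> K"
        have "dist (x, F (k n) x, P (k n) x) (x, Fl x, Pl x) \<le> dist (F (k n) x) (Fl x) + dist (P (k n) x) (Pl x)"
          by (simp add: dist_Pair_Pair sqrt_sum_squares_le_sum)
        then show "dist (x, F (k n) x, P (k n) x) (x, Fl x, Pl x) < e" 
          using elim \<open>x \<in> K\<close> by fastforce
      qed
    qed
  qed
  \<comment> \<open>No further extraction is needed for the second derivatives: they are a uniformly
    continuous function of data that already converge uniformly.\<close>
  have uPhi: "uniform_limit K (\<lambda>n x. \<Phi> i u (x, F (k n) x, P (k n) x)) (\<lambda>x. \<Phi> i u (x, Fl x, Pl x)) sequentially"
    for i u
    by (rule uniform_limit_compose_uniformly_continuous_on[OF uZ 
          compact_uniformly_continuous[OF \<Phi>c Z] _ compact_imp_closed[OF Z]]) (use inZ in auto)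
  have dFl: "(Fl has_derivative Pl x) (at x within K)" if "x \<in> K" for x
  proof (rule has_derivative_uniform_limit[OF K(2) has_derivative_at_withinI[OF d1] _ limk that])
    fix e :: real assume "e > 0"
    from uniform_limitD[OF uP this]
    show "\<forall>\<^sub>F n in sequentially. \<forall>x\<in>K. \<forall>v. norm (fder (F (k n)) x v - Pl x v) \<le> e * norm v"
    proof eventually_elim
      case (elim n)
      have "norm (fder (F (k n)) x v - Pl x v) \<le> e * norm v" if "x \<in> K" for x v
      proof -
        have "norm (fder (F (k n)) x v - Pl x v) = norm ((P (k n) x - Pl x) v)"
          by (simp add: P[OF that] blinfun.diff_left)
        also have "\<dots> \<le> norm (P (k n) x - Pl x) * norm v" by (rule norm_blinfun)
        also have "\<dots> \<le> e * norm v" using elim that 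
          by (intro mult_right_mono) (auto simp: dist_norm less_imp_le)
        finally show ?thesis .
      qed
      then show ?case by blast
    qed
  qed
  have limP: "(\<lambda>n. fder (F (k n)) x u) \<longlonglongrightarrow> Pl x u" if "x \<in> K" for x u
  proof -
    have "(\<lambda>n. P (k n) x u) \<longlonglongrightarrow> Pl x u"
      by (intro blinfun.tendsto tendsto_uniform_limitI[OF uP that] tendsto_const)
    then show ?thesis by (simp add: P[OF that])
  qed
  have dPl: "((\<lambda>x. Pl x u) has_derivative (\<lambda>w. \<Sum>i\<in>Basis. (w \<bullet> i) *\<^sub>R \<Phi> i u (x, Fl x, Pl x))) (at x within K)"
    if "x \<in> K" for x u
  proof (rule has_derivative_uniform_limit[OF K(2) has_derivative_at_withinI[OF D2] _ limP that])
    fix e :: real assume "e > 0"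
    define d where "d = e / DIM('e)"
    have "d > 0" using \<open>e > 0\<close> by (simp add: d_def)
    have "\<forall>\<^sub>F n in sequentially. \<forall>i\<in>Basis. \<forall>x\<in>K. 
        dist (\<Phi> i u (x, F (k n) x, P (k n) x)) (\<Phi> i u (x, Fl x, Pl x)) < d"
      by (rule eventually_ball_finite) (use uniform_limitD[OF uPhi \<open>d > 0\<close>] in auto)
    then show "\<forall>\<^sub>F n in sequentially. \<forall>x\<in>K. \<forall>w. norm ((\<Sum>i\<in>Basis. (w \<bullet> i) *\<^sub>R \<Phi> i u (x, F (k n) x, P (k n) x))
        - (\<Sum>i\<in>Basis. (w \<bullet> i) *\<^sub>R \<Phi> i u (x, Fl x, Pl x))) \<le> e * norm w"
    proof eventually_elim
      case (elim n)
      have "norm ((\<Sum>i\<in>Basis. (w \<bullet> i) *\<^sub>R \<Phi> i u (x, F (k n) x, P (k n) x))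
        - (\<Sum>i\<in>Basis. (w \<bullet> i) *\<^sub>R \<Phi> i u (x, Fl x, Pl x))) \<le> e * norm w" if "x \<in> K" for x w
      proof -
        have "norm (\<Sum>i\<in>Basis. (w \<bullet> i) *\<^sub>R (\<Phi> i u (x, F (k n) x, P (k n) x) - \<Phi> i u (x, Fl x, Pl x)))
          \<le> (\<Sum>i\<in>(Basis::'e set). norm w * d)"
        proof (rule sum_norm_le)
          fix i :: 'e assume i: "i \<in> Basis"
          show "norm ((w \<bullet> i) *\<^sub>R (\<Phi> i u (x, F (k n) x, P (k n) x) - \<Phi> i u (x, Fl x, Pl x))) \<le> norm w * d"
            unfolding norm_scaleR using elim i that Basis_le_norm[OF i]
            by (intro mult_mono) (auto simp: dist_norm less_imp_le)
        qed
        also have "\<dots> = e * norm w" by (simp add: d_def)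
        finally show ?thesis by (simp add: scaleR_diff_right sum_subtractf)
      qed
      then show ?case by blast
    qed
  qed
  \<comment> \<open>On the closed ball the limit theorems give derivatives within \<open>K\<close>;
    at interior points these are full derivatives, which is why the conclusions are stated on the
    open ball.\<close>
  have int: "at x within K = at x" if "x \<in> ball x0 r" for x
    by (rule at_within_interior) (use that r in \<open>simp add: K_def\<close>)
  have ballK: "ball x0 r \<subseteq> K" by (auto simp: K_def)
  have FlK': "Fl x \<in> K'" if "x \<in> K" for x
    using closed_sequentially[OF compact_imp_closed[OF K'(1)] _ limk[OF that]] FK that by blast
  show "smooth_on (ball x0 r) Fl"
  proof (rule smooth_on_isometric_bootstrap[OF g h])
    show "(Fl has_derivative Pl x) (at x)" if "x \<in> ball x0 r" for x
      using dFl[of x] int[OF that] ballK that by auto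
    show "((\<lambda>x. Pl x u) has_derivative (\<lambda>w. \<Sum>i\<in>Basis. (w \<bullet> i) *\<^sub>R 
        Pl x (koszul_vector g h x (Fl x) (Pl x) i u))) (at x)" if "x \<in> ball x0 r" for x u
      using dPl[of x u] int[OF that] ballK that by (auto simp: \<Phi>_def)
  qed (use ballK K(3) FlK' K'(2) in auto)
  fix x u v assume x: "x \<in> ball x0 r"
  then have xK: "x \<in> K" using ballK by blast
  have fd: "fder Fl x = Pl x" by (rule fder_eq) (use dFl[OF xK] int[OF x] in simp)
  have lim2: "(\<lambda>n. h (F (k n) x) (fder (F (k n)) x u) (fder (F (k n)) x v)) \<longlonglongrightarrow> h (Fl x) (Pl x u) (Pl x v)"
    by (rule metric_tendsto[OF h _ limk[OF xK] limP[OF xK] limP[OF xK]]) (use FlK'[OF xK] K'(2) in blast)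
  have eqk: "h (F (k n) x) (fder (F (k n)) x u) (fder (F (k n)) x v) = g x u v" for n
    using iso K(4) xK by blast
  show "h (Fl x) (fder Fl x u) (fder Fl x v) = g x u v"
    using LIMSEQ_unique[OF lim2[unfolded eqk] tendsto_const] fd by simp
qed

section \<open>Local isometries of a Riemannian manifold\<close>

abbreviation chart_image :: "('a, 'e) chart \<Rightarrow> 'e set" where
  "chart_image c \<equiv> snd c ` fst c"

abbreviation chart_inv :: "('a, 'e) chart \<Rightarrow> 'e \<Rightarrow> 'a" where
  "chart_inv c \<equiv> inv_into (fst c) (snd c)"

lemma is_chartD:
  fixes c :: "('a::topological_space, 'e::euclidean_space) chart"
  assumes "is_chart c"
  shows "open (fst c)" "open (chart_image c)"
    and "\<And>x. x \<in> fst c \<Longrightarrow> chart_inv c (snd c x) = x"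
    and "\<And>z. z \<in> chart_image c \<Longrightarrow> snd c (chart_inv c z) = z"
    and "\<And>z. z \<in> chart_image c \<Longrightarrow> chart_inv c z \<in> fst c"
    and "continuous_on (fst c) (snd c)" "continuous_on (chart_image c) (chart_inv c)"
    and "\<And>V. open V \<Longrightarrow> V \<subseteq> fst c \<Longrightarrow> open (snd c ` V)"
    and "\<And>W. open W \<Longrightarrow> W \<subseteq> chart_image c \<Longrightarrow> open (chart_inv c ` W)"
proof -
  have hom: "homeomorphism (fst c) (chart_image c) (snd c) (chart_inv c)"
    and o: "open (fst c)" "open (chart_image c)"
    using assms by (auto simp: is_chart_def)
  show "open (fst c)" "open (chart_image c)" by (rule o)+
  show "\<And>x. x \<in> fst c \<Longrightarrow> chart_inv c (snd c x) = x"
    using hom by (simp add: homeomorphism_def)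
  show "\<And>z. z \<in> chart_image c \<Longrightarrow> snd c (chart_inv c z) = z"
    by (rule f_inv_into_f)
  show "\<And>z. z \<in> chart_image c \<Longrightarrow> chart_inv c z \<in> fst c" by (rule inv_into_into)
  show "continuous_on (fst c) (snd c)" "continuous_on (chart_image c) (chart_inv c)"
    using hom by (simp_all add: homeomorphism_def)
  show "open (snd c ` V)" if "open V" "V \<subseteq> fst c" for V
  proof -
    have "openin (top_of_set (fst c)) V" using that o(1) by (simp add: openin_open_eq)
    then have "openin (top_of_set (chart_image c)) (snd c ` V)" 
      by (rule homeomorphism_imp_open_map[OF hom])
    then show ?thesis using o(2) openin_open_eq by blast
  qed
  show "open (chart_inv c ` W)" if "open W" "W \<subseteq> chart_image c" for W
  proof -
    have "openin (top_of_set (chart_image c)) W" using that o(2) by (simp add: openin_open_eq)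
    then have "openin (top_of_set (fst c)) (chart_inv c ` W)"
      using homeomorphism_imp_open_map[of "chart_image c" "fst c" "chart_inv c" "snd c" W]
        hom homeomorphism_sym by blast
    then show ?thesis using o(1) openin_open_eq by blast
  qed
qed

lemma rep_dom_iff:
  assumes "is_chart c"
  shows "z \<in> rep_dom c c' f \<longleftrightarrow> z \<in> chart_image c \<and> f (chart_inv c z) \<in> fst c'"
  using is_chartD[OF assms] by (auto simp: rep_dom_def)

lemma local_rep_apply: "local_rep c c' f z = snd c' (f (chart_inv c z))"
  by (simp add: local_rep_def)

lemma open_rep_dom:
  assumes "is_chart c" "is_chart c'" "continuous_on UNIV f"
  shows "open (rep_dom c c' f)"
proof -
  have "open (f -` fst c')" using assms(3) is_chartD(1)[OF assms(2)] by (simp add: open_vimage)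
  then show ?thesis
    unfolding rep_dom_def using is_chartD(1,8)[OF assms(1)] by (simp add: open_Int)
qed

locale riemannian =
  fixes A :: "('a::{t2_space,second_countable_topology}, 'e::euclidean_space) chart set"
    and g :: "('a, 'e) metric_tensor"
  assumes riemannian_manifold: "riemannian_manifold A g"
begin

lemma chart: "c \<in> A \<Longrightarrow> is_chart c"
  using riemannian_manifold by (simp add: riemannian_manifold_def smooth_atlas_def)

lemma ex_chart: obtains c where "c \<in> A" "x \<in> fst c"
proof -
  have "x \<in> (\<Union>c\<in>A. fst c)"
    using riemannian_manifold by (simp add: riemannian_manifold_def smooth_atlas_def)
  then show ?thesis using that by blast
qed

lemma chart_metric_on: "c \<in> A \<Longrightarrow> metric_on (chart_image c) (g c)"
  using riemannian_manifold is_chartD(2)[OF chart, of c]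
  by (auto simp: riemannian_manifold_def riemannian_metric_def metric_on_def posdef_form_def)

text \<open>Only first-order information is required, enough for the Lipschitz estimate. Thus
  \<open>k \<circ> f\<close> with \<open>k\<close> an inverse isometry is covered by the chain rule
  alone, without composing smooth maps between charts.\<close>

definition loc_isom :: "('a \<Rightarrow> 'a) \<Rightarrow> bool" where
  "loc_isom f \<longleftrightarrow> continuous_on UNIV f \<and>
     (\<forall>c\<in>A. \<forall>c'\<in>A. \<forall>z\<in>rep_dom c c' f. local_rep c c' f differentiable (at z)) \<and>
     preserves_metric A g f"

lemma loc_isomD:
  assumes "loc_isom f"
  shows "continuous_on UNIV f"
    and "\<And>c c' z. c \<in> A \<Longrightarrow> c' \<in> A \<Longrightarrow> z \<in> rep_dom c c' f \<Longrightarrow>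
      (local_rep c c' f has_derivative fder (local_rep c c' f) z) (at z)"
    and "\<And>c c' z u v. c \<in> A \<Longrightarrow> c' \<in> A \<Longrightarrow> z \<in> rep_dom c c' f \<Longrightarrow>
      g c' (local_rep c c' f z) (fder (local_rep c c' f) z u) (fder (local_rep c c' f) z v) = g c z u v"
  using assms fder_works unfolding loc_isom_def preserves_metric_def by blast+

lemma loc_isomI:
  assumes "continuous_on UNIV f"
    and "\<And>c c' z. c \<in> A \<Longrightarrow> c' \<in> A \<Longrightarrow> z \<in> rep_dom c c' f \<Longrightarrow>
      \<exists>D. (local_rep c c' f has_derivative D) (at z) \<and>
          (\<forall>u v. g c' (local_rep c c' f z) (D u) (D v) = g c z u v)"
  shows "loc_isom f"
  unfolding loc_isom_def preserves_metric_def
proof (intro conjI ballI allI assms(1))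
  fix c c' z assume *: "c \<in> A" "c' \<in> A" "z \<in> rep_dom c c' f"
  from assms(2)[OF this] obtain D where D: "(local_rep c c' f has_derivative D) (at z)"
    "\<forall>u v. g c' (local_rep c c' f z) (D u) (D v) = g c z u v" by blast
  show "local_rep c c' f differentiable (at z)" using D(1) by (auto simp: differentiable_def)
  show "g c' (local_rep c c' f z) (fder (local_rep c c' f) z u) (fder (local_rep c c' f) z v) = g c z u v" for u v
    using D fder_eq by metis
qed

text \<open>Near a point the composition factors through a chart \<open>d\<close> around the
  intermediate value; the two representations agree on an open set only, which suffices for
  derivatives.\<close>

lemma loc_isom_comp:
  assumes f: "loc_isom f" and k: "loc_isom k"
  shows "loc_isom (k \<circ> f)"
proof (rule loc_isomI)
  show cont: "continuous_on UNIV (k \<circ> f)"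
    using loc_isomD(1)[OF f] loc_isomD(1)[OF k] continuous_on_compose continuous_on_subset by blast
  fix c c' z assume c: "c \<in> A" "c' \<in> A" and z: "z \<in> rep_dom c c' (k \<circ> f)"
  note cc = chart[OF c(1)] chart[OF c(2)]
  obtain d where d: "d \<in> A" "f (chart_inv c z) \<in> fst d" by (rule ex_chart)
  note dd = chart[OF d(1)]
  have zf: "z \<in> rep_dom c d f" using z d(2) by (simp add: rep_dom_iff[OF cc(1)])
  define F where "F = local_rep c d f"
  have rep: "F w \<in> rep_dom d c' k \<and> local_rep d c' k (F w) = local_rep c c' (k \<circ> f) w"
    if "w \<in> rep_dom c d f" "w \<in> rep_dom c c' (k \<circ> f)" for w
    using that is_chartD(3)[OF dd] by (auto simp: rep_dom_iff[OF cc(1)] rep_dom_iff[OF dd] F_def local_rep_apply)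
  have zk: "F z \<in> rep_dom d c' k" using rep[OF zf z] by blast
  let ?D = "\<lambda>u. fder (local_rep d c' k) (F z) (fder F z u)"
  have dF: "(F has_derivative fder F z) (at z)" unfolding F_def by (rule loc_isomD(2)[OF f c(1) d(1) zf])
  have "((\<lambda>w. local_rep d c' k (F w)) has_derivative ?D) (at z)"
    by (rule has_derivative_compose[OF dF loc_isomD(2)[OF k d(1) c(2) zk]])
  moreover have "open (rep_dom c d f \<inter> rep_dom c c' (k \<circ> f))"
    using open_rep_dom[OF cc(1) dd loc_isomD(1)[OF f]] open_rep_dom[OF cc cont] by blast
  ultimately have "(local_rep c c' (k \<circ> f) has_derivative ?D) (at z)"
    by (rule has_derivative_transform_within_open) (use z zf rep in auto)
  moreover have "g c' (local_rep c c' (k \<circ> f) z) (?D u) (?D v) = g c z u v" for u v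
  proof -
    have "g c' (local_rep c c' (k \<circ> f) z) (?D u) (?D v) = g d (F z) (fder F z u) (fder F z v)"
      using loc_isomD(3)[OF k d(1) c(2) zk] rep[OF zf z] by metis
    also have "\<dots> = g c z u v" unfolding F_def by (rule loc_isomD(3)[OF f c(1) d(1) zf])
    finally show ?thesis .
  qed
  ultimately show "\<exists>D. (local_rep c c' (k \<circ> f) has_derivative D) (at z) \<and>
          (\<forall>u v. g c' (local_rep c c' (k \<circ> f) z) (D u) (D v) = g c z u v)" by blast
qed

lemma smooth_map_has_derivative:
  assumes "smooth_map A f" "c \<in> A" "c' \<in> A" "z \<in> rep_dom c c' f"
  shows "(local_rep c c' f has_derivative fder (local_rep c c' f) z) (at z)"
proof -
  have "Ck_on (Suc 0) (rep_dom c c' f) (local_rep c c' f)"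
    using assms(1-3) by (auto simp: smooth_map_def smooth_on_def simp del: Ck_on.simps)
  then show ?thesis using Ck_on_SucD(2) assms(4) by blast
qed

lemma isometriesD:
  assumes "f \<in> isometries A g"
  shows "bij f" "smooth_map A f" "smooth_map A (inv_into UNIV f)" "preserves_metric A g f"
    and "\<And>x. inv_into UNIV f (f x) = x" "\<And>x. f (inv_into UNIV f x) = x"
  using assms by (auto simp: isometries_def diffeomorphism_def bij_is_inj bij_is_surj surj_f_inv_f)

lemma isometry_loc_isom: "f \<in> isometries A g \<Longrightarrow> loc_isom f"
  unfolding loc_isom_def
  using smooth_map_has_derivative[OF isometriesD(2), THEN differentiableI] isometriesD(2,4)[of f]
  by (auto simp: smooth_map_def)

text \<open>Differentiating \<open>F (H w) = w\<close> shows that the derivative of \<open>F\<close>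
  undoes that of \<open>H\<close>; preservation by \<open>F\<close>, applied to the vectors
  \<open>fder H z u\<close>, is then preservation by \<open>H\<close>.\<close>

lemma isometry_inv_loc_isom:
  assumes "f \<in> isometries A g"
  shows "loc_isom (inv_into UNIV f)"
proof (rule loc_isomI)
  note f = isometriesD[OF assms]
  have fl: "loc_isom f" by (rule isometry_loc_isom[OF assms])
  show cont: "continuous_on UNIV (inv_into UNIV f)" using f(3) by (simp add: smooth_map_def)
  fix c c' z assume c: "c \<in> A" "c' \<in> A" and z: "z \<in> rep_dom c c' (inv_into UNIV f)"
  note cc = chart[OF c(1)] chart[OF c(2)]
  define H where "H = local_rep c c' (inv_into UNIV f)"
  define F where "F = local_rep c' c f"
  have rep: "H w \<in> rep_dom c' c f \<and> F (H w) = w" if "w \<in> rep_dom c c' (inv_into UNIV f)" for w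
    using that is_chartD(3-5)[OF cc(1)] is_chartD(3)[OF cc(2)] f(6)
    by (auto simp: rep_dom_iff[OF cc(1)] rep_dom_iff[OF cc(2)] F_def H_def local_rep_apply)
  have dH: "(H has_derivative fder H z) (at z)"
    unfolding H_def by (rule smooth_map_has_derivative[OF f(3) c z])
  have dF: "(F has_derivative fder F (H z)) (at (H z))"
    unfolding F_def by (rule loc_isomD(2)[OF fl c(2,1)]) (use rep[OF z] in \<open>simp add: F_def\<close>)
  have "((\<lambda>w. F (H w)) has_derivative (\<lambda>u. fder F (H z) (fder H z u))) (at z)"
    by (rule has_derivative_compose[OF dH dF])
  then have "((\<lambda>w. w) has_derivative (\<lambda>u. fder F (H z) (fder H z u))) (at z)"
    by (rule has_derivative_transform_within_open[OF _ open_rep_dom[OF cc cont] z]) (use rep in auto)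
  from has_derivative_unique[OF this has_derivative_ident]
  have id: "fder F (H z) (fder H z u) = u" for u by metis
  have "g c' (H z) (fder H z u) (fder H z v) = g c z u v" for u v
  proof -
    have "g c (F (H z)) (fder F (H z) (fder H z u)) (fder F (H z) (fder H z v)) = g c' (H z) (fder H z u) (fder H z v)"
      unfolding F_def by (rule loc_isomD(3)[OF fl c(2,1)]) (use rep[OF z] in \<open>simp add: F_def\<close>)
    then show ?thesis using id rep[OF z] by simp
  qed
  then show "\<exists>D. (local_rep c c' (inv_into UNIV f) has_derivative D) (at z) \<and>
          (\<forall>u v. g c' (local_rep c c' (inv_into UNIV f) z) (D u) (D v) = g c z u v)"
    using dH unfolding H_def by blast
qed

section \<open>Local compactness and even continuity\<close>

text \<open>Local compactness is inherited from the model space: closed coordinate balls are compact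
  neighbourhoods.\<close>

lemma compact_neighbourhood:
  fixes x :: 'a
  assumes "open W" "x \<in> W"
  obtains V C where "open V" "compact C" "x \<in> V" "V \<subseteq> C" "C \<subseteq> W"
proof -
  obtain c where c: "c \<in> A" "x \<in> fst c" by (rule ex_chart)
  note cc = is_chartD[OF chart[OF c(1)]]
  have "open (snd c ` (W \<inter> fst c))" using cc(8)[of "W \<inter> fst c"] assms(1) cc(1) by blast
  moreover have "snd c x \<in> snd c ` (W \<inter> fst c)" using assms(2) c(2) by blast
  ultimately obtain r where r: "r > 0" "cball (snd c x) r \<subseteq> snd c ` (W \<inter> fst c)"
    using open_contains_cball by blast
  have sub: "cball (snd c x) r \<subseteq> chart_image c" using r(2) by blast
  show ?thesis
  proof
    show "open (chart_inv c ` ball (snd c x) r)"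
      by (rule cc(9)) (use sub ball_subset_cball in auto)
    show "compact (chart_inv c ` cball (snd c x) r)"
      by (rule compact_continuous_image[OF continuous_on_subset[OF cc(7) sub] compact_cball])
    show "x \<in> chart_inv c ` ball (snd c x) r"
      using cc(3)[OF c(2)] r(1) by (metis centre_in_ball image_eqI)
    show "chart_inv c ` ball (snd c x) r \<subseteq> chart_inv c ` cball (snd c x) r" by auto
    show "chart_inv c ` cball (snd c x) r \<subseteq> W" using r(2) cc(3) by fastforce
  qed
qed

text \<open>In charts, local isometries are Lipschitz with a common constant as long as they stay in a fixed
  compact ball; following the image of a segment shows that it cannot leave the ball.  The
  neighbourhoods \<open>V\<close> and \<open>Y\<close> do not depend on the local isometry.\<close>

lemma loc_isom_evenly_continuous:
  fixes x y :: 'a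
  assumes "open W" "y \<in> W"
  obtains V Y where "open V" "x \<in> V" "open Y" "y \<in> Y"
    and "\<And>f z w. loc_isom f \<Longrightarrow> z \<in> V \<Longrightarrow> f z \<in> Y \<Longrightarrow> w \<in> V \<Longrightarrow> f w \<in> W"
proof -
  obtain c where c: "c \<in> A" "x \<in> fst c" by (rule ex_chart)
  obtain c' where c': "c' \<in> A" "y \<in> fst c'" by (rule ex_chart)
  note cc = is_chartD[OF chart[OF c(1)]]
  note cc' = is_chartD[OF chart[OF c'(1)]]
  define a where "a = snd c x"
  define b where "b = snd c' y"
  obtain R where R: "R > 0" "cball a R \<subseteq> chart_image c"
    using cc(2) c(2) open_contains_cball by (metis a_def image_eqI)
  have "open (snd c' ` (W \<inter> fst c'))" using cc'(8)[of "W \<inter> fst c'"] assms(1) cc'(1) by blast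
  moreover have "b \<in> snd c' ` (W \<inter> fst c')" using assms(2) c'(2) by (auto simp: b_def)
  ultimately obtain R' where R': "R' > 0" "cball b R' \<subseteq> snd c' ` (W \<inter> fst c')"
    using open_contains_cball by blast
  then have sub: "cball b R' \<subseteq> chart_image c'" by blast
  then have bsub: "ball b s \<subseteq> chart_image c'" if "s \<le> R'" for s using that by auto
  have toW: "chart_inv c' q \<in> W" if "q \<in> cball b R'" for q
    using R'(2) that cc'(3) by fastforce
  obtain L where L: "L > 0" "\<forall>z\<in>cball a R. \<forall>q\<in>cball b R'. \<forall>D. (\<forall>u v. g c' q (D u) (D v) = g c z u v) \<longrightarrow>
      (\<forall>u. norm (D u) \<le> L * norm u)"
    using isometric_derivative_bounds[OF chart_metric_on[OF c(1)] compact_cball R(2)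
        chart_metric_on[OF c'(1)] compact_cball sub] by blast
  \<comment> \<open>Two points of the ball of radius \<open>\<rho>\<close> are less than
    \<open>2 * \<rho>\<close> apart, so the image of their segment moves by at most
    \<open>R' / 4\<close>. Starting within \<open>R' / 2\<close> of \<open>b\<close>, it stays
    within \<open>3 * R' / 4\<close>, strictly inside the ball of radius \<open>R'\<close>.\<close>
  define \<rho> where "\<rho> = min R (R' / (8 * L))"
  have \<rho>: "\<rho> > 0" "\<rho> \<le> R" "L * (2 * \<rho>) \<le> R' / 4"
    using R(1) R'(1) L(1) by (auto simp: \<rho>_def min_def field_simps)
  \<comment> \<open>The open and the closed coordinate ball seen in the manifold. Openness of
    \<open>B\<close> provides a first exit time, closedness of \<open>C\<close> keeps the path in
    the chart domain at that time.\<close>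
  define B where "B = chart_inv c' ` ball b R'"
  define C where "C = chart_inv c' ` cball b R'"
  have "open B" unfolding B_def by (rule cc'(9)) (use bsub in auto)
  have "compact C" unfolding C_def
    by (rule compact_continuous_image[OF continuous_on_subset[OF cc'(7) sub] compact_cball])
  then have "closed C" by (rule compact_imp_closed)
  have BC: "B \<subseteq> C" by (auto simp: B_def C_def)
  have C: "snd c' q \<in> cball b R' \<and> q \<in> fst c'" if "q \<in> C" for q
    using that sub cc'(4,5) by (auto simp: C_def)
  have Bi: "q \<in> B" if "q \<in> fst c'" "snd c' q \<in> ball b R'" for q
    using that cc'(3)[of q] by (auto simp: B_def image_iff intro!: bexI[of _ "snd c' q"])
  show ?thesis
  proof
    show "open (chart_inv c ` ball a \<rho>)"
      by (rule cc(9)) (use R(2) \<rho>(2) in auto)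
    show "open (chart_inv c' ` ball b (R' / 2))" by (rule cc'(9)) (use bsub R'(1) in auto)
    show "x \<in> chart_inv c ` ball a \<rho>"
      using \<rho>(1) cc(3)[OF c(2)] by (auto simp: a_def image_iff intro!: bexI[of _ a])
    show "y \<in> chart_inv c' ` ball b (R' / 2)"
      using R'(1) cc'(3)[OF c'(2)] by (auto simp: b_def image_iff intro!: bexI[of _ b])
    fix f z w
    assume f: "loc_isom f" and "z \<in> chart_inv c ` ball a \<rho>" "w \<in> chart_inv c ` ball a \<rho>"
      and fz: "f z \<in> chart_inv c' ` ball b (R' / 2)"
    then obtain p q where p: "p \<in> ball a \<rho>" "z = chart_inv c p" and q: "q \<in> ball a \<rho>" "w = chart_inv c q"
      by blast
    have pq: "norm (q - p) < 2 * \<rho>"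
      using p(1) q(1) dist_triangle_less_add[of p a \<rho> q \<rho>] by (simp add: dist_norm norm_minus_commute)
    define \<gamma> where "\<gamma> = (\<lambda>t. p + t *\<^sub>R (q - p))"
    have gb: "\<gamma> t \<in> ball a \<rho>" if "t \<in> {0..1}" for t
    proof -
      have "\<gamma> t = (1 - t) *\<^sub>R p + t *\<^sub>R q" by (simp add: \<gamma>_def algebra_simps)
      then show ?thesis using convexD_alt[OF convex_ball p(1) q(1), of t] that by simp
    qed
    have gR: "\<gamma> t \<in> cball a R" "\<gamma> t \<in> chart_image c" if "t \<in> {0..1}" for t
      using gb[OF that] \<rho>(2) R(2) by auto
    define P where "P = (\<lambda>t. f (chart_inv c (\<gamma> t)))"
    have Pc: "continuous_on {0..1} P"
      unfolding P_def
    proof (rule continuous_on_compose2[OF loc_isomD(1)[OF f]])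
      show "continuous_on {0..1} (\<lambda>t. chart_inv c (\<gamma> t))"
        by (rule continuous_on_compose2[OF cc(7)]) 
          (use gR in \<open>auto simp: \<gamma>_def intro!: continuous_intros\<close>)
    qed auto
    have P0: "P 0 = f z" by (simp add: P_def \<gamma>_def p)
    have "P t \<in> B" if t: "t \<in> {0..1}" for t
    proof (rule ccontr)
      assume "P t \<notin> B"
      \<comment> \<open>The times at which the path is outside \<open>B\<close>: a compact set, so
        there is a first one, \<open>s\<close>. The estimate at time \<open>s\<close> will put
        \<open>P s\<close> back into \<open>B\<close>.\<close>
      define N where "N = {0..1} \<inter> P -` (- B)"
      have "closed N"
        unfolding N_def by (rule continuous_closed_preimage[OF Pc]) (use \<open>open B\<close> in auto)
      then have "compact ({0..1} \<inter> N)" by (intro compact_Int_closed compact_Icc)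
      then have "compact N" by (simp add: N_def)
      moreover have "t \<in> N" using t \<open>P t \<notin> B\<close> by (simp add: N_def)
      ultimately obtain s where s: "s \<in> N" "\<And>t. t \<in> N \<Longrightarrow> s \<le> t"
        using compact_attains_inf by (metis empty_iff)
      have s1: "s \<in> {0..1}" "P s \<notin> B" using s(1) by (auto simp: N_def)
      have before: "P t \<in> B" if "0 \<le> t" "t < s" for t
        using s(2)[of t] that s1(1) by (auto simp: N_def)
      obtain q0 where q0: "q0 \<in> ball b (R' / 2)" "f z = chart_inv c' q0" using fz by blast
      have fz': "snd c' (f z) = q0" "f z \<in> fst c'"
        using cc'(4,5)[of q0] bsub[of "R' / 2"] q0 R'(1) by auto
      have "f z \<in> B" by (rule Bi) (use fz' q0 R'(1) in auto)
      then have "s > 0" using s1 P0 by (cases "s = 0") auto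
      \<comment> \<open>Before \<open>s\<close> the path lies in \<open>B\<close>, hence at
        \<open>s\<close> in the closed set \<open>C\<close>. The coordinate path is therefore
        continuous on all of \<open>{0..s}\<close>, as the mean value theorem requires.\<close>
      have PC: "P t \<in> C" if "t \<in> {0..s}" for t
      proof -
        have "P ` closure {0..<s} \<subseteq> C"
        proof (rule image_closure_subset[OF _ \<open>closed C\<close>])
          show "continuous_on (closure {0..<s}) P"
            using \<open>s > 0\<close> s1(1) by (auto intro: continuous_on_subset[OF Pc])
          show "P ` {0..<s} \<subseteq> C" using before BC by auto
        qed
        then show ?thesis using \<open>s > 0\<close> that by (simp add: image_subset_iff)
      qed
      define F where "F = local_rep c c' f"
      have FP: "F (\<gamma> t) = snd c' (P t)" for t by (simp add: F_def P_def local_rep_apply)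
      have "continuous_on {0..s} (\<lambda>t. snd c' (P t))"
        by (rule continuous_on_compose2[OF cc'(6) continuous_on_subset[OF Pc]]) (use s1 PC C in auto)
      then have cont: "continuous_on {0..s} (\<lambda>t. F (\<gamma> t))" by (simp add: FP)
      have dom: "\<gamma> t \<in> rep_dom c c' f" if "t \<in> {0..s}" for t
        using gR(2)[of t] that s1 PC[OF that] C by (auto simp: rep_dom_iff[OF chart[OF c(1)]] P_def)
      have "((\<lambda>t. F (\<gamma> t)) has_derivative (\<lambda>h. fder F (\<gamma> t) (h *\<^sub>R (q - p)))) (at t)"
        if "0 < t" "t < s" for t
      proof -
        have d1: "(\<gamma> has_derivative (\<lambda>h. h *\<^sub>R (q - p))) (at t)"
          unfolding \<gamma>_def by (auto intro!: derivative_eq_intros)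
        have d2: "(F has_derivative fder F (\<gamma> t)) (at (\<gamma> t))"
          unfolding F_def by (rule loc_isomD(2)[OF f c(1) c'(1) dom]) (use that in auto)
        show ?thesis by (rule has_derivative_compose[OF d1 d2])
      qed
      from mvt_general[OF \<open>s > 0\<close> cont this]
      obtain t where t: "t \<in> {0<..<s}"
        "norm (F (\<gamma> s) - F (\<gamma> 0)) \<le> norm (fder F (\<gamma> t) ((s - 0) *\<^sub>R (q - p)))" by blast
      have ts: "t \<in> {0..s}" "t \<in> {0..1}" using t(1) s1(1) by auto
      have "F (\<gamma> t) \<in> cball b R'" using PC[OF ts(1)] C by (auto simp: FP)
      moreover have "g c' (F (\<gamma> t)) (fder F (\<gamma> t) u) (fder F (\<gamma> t) v) = g c (\<gamma> t) u v" for u v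
        unfolding F_def by (rule loc_isomD(3)[OF f c(1) c'(1) dom[OF ts(1)]])
      ultimately have "norm (fder F (\<gamma> t) u) \<le> L * norm u" for u
        using L(2) gR(1)[OF ts(2)] by blast
      then have "norm (F (\<gamma> s) - F (\<gamma> 0)) \<le> L * norm ((s - 0) *\<^sub>R (q - p))" using t(2) order_trans by blast
      also have "\<dots> \<le> L * (2 * \<rho>)"
      proof (rule mult_left_mono)
        have "s * norm (q - p) \<le> 1 * norm (q - p)" by (rule mult_right_mono) (use s1 in auto)
        then show "norm ((s - 0) *\<^sub>R (q - p)) \<le> 2 * \<rho>" using pq \<open>s > 0\<close> by simp
      qed (use L(1) in simp)
      also have "\<dots> \<le> R' / 4" by (rule \<rho>(3))
      finally have "dist (snd c' (P s)) q0 \<le> R' / 4" using fz' by (simp add: FP P0 dist_norm)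
      moreover have "dist b q0 < R' / 2" using q0(1) by simp
      ultimately have "dist b (snd c' (P s)) < R'"
        using dist_triangle3[of b "snd c' (P s)" q0] R'(1) by (simp add: dist_commute)
      moreover have "P s \<in> fst c'" using PC[of s] C \<open>s > 0\<close> by auto
      ultimately have "P s \<in> B" by (intro Bi) auto
      then show False using s1(2) by contradiction
    qed
    then have "P 1 \<in> B" by simp
    then show "f w \<in> W" using toW by (auto simp: P_def \<gamma>_def q B_def)
  qed
qed

end

section \<open>Sequences of isometries and closures of orbits\<close>

lemma eventually_image_subset_imp_limit_in_closed:
  assumes lim: "\<And>x. (\<lambda>n. f n x) \<longlonglongrightarrow> l x" and "\<forall>\<^sub>F n in sequentially. f n ` V \<subseteq> B" "B \<subseteq> C" "closed C"
  shows "l ` V \<subseteq> C"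
proof
  fix y assume "y \<in> l ` V"
  then obtain x where x: "x \<in> V" "y = l x" by blast
  have "\<forall>\<^sub>F n in sequentially. f n x \<in> C" using assms(2) by eventually_elim (use x assms(3) in blast)
  then show "y \<in> C" using Lim_in_closed_set[OF assms(4) _ _ lim[of x]] x by simp
qed

lemma tendsto_imp_compact_superset:
  fixes a :: "nat \<Rightarrow> 'b::topological_space"
  assumes "a \<longlonglongrightarrow> l" "open V" "l \<in> V" "V \<subseteq> C" "compact C"
  obtains K where "compact K" "\<And>n. a n \<in> K"
proof -
  obtain N where N: "\<And>n. n \<ge> N \<Longrightarrow> a n \<in> V"
    using topological_tendstoD[OF assms(1-3)] by (auto simp: eventually_sequentially)
  have "compact (C \<union> a ` {..<N})" using assms(5) by (simp add: compact_Un finite_imp_compact)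
  moreover have "a n \<in> C \<union> a ` {..<N}" for n using N[of n] assms(4) by (cases "n < N") auto
  ultimately show ?thesis using that by blast
qed

context riemannian
begin

section \<open>Relative compactness of orbits and convergent subsequences\<close>

text \<open>\<open>H\<close> is an arbitrary set, later the range of a sequence. Inverses of its
  members enter the proof only as local isometries and may lie outside \<open>H\<close>.\<close>

lemma isometries_pointwise_relatively_compact:
  assumes conn: "connected (UNIV :: 'a set)" and H: "H \<subseteq> isometries A g"
    and p: "compact K0" "\<And>f. f \<in> H \<Longrightarrow> f p \<in> K0"
  shows "\<exists>K. compact K \<and> (\<forall>f\<in>H. f x \<in> K)"
proof -
  define S where "S = {x. \<exists>K. compact K \<and> (\<forall>f\<in>H. f x \<in> K)}"
  have li: "loc_isom f" if "f \<in> H" for f using that H isometry_loc_isom by blast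
  have "open S"
  proof (subst open_subopen, rule ballI)
    fix x assume "x \<in> S"
    then obtain K where K: "compact K" "\<And>f. f \<in> H \<Longrightarrow> f x \<in> K" by (auto simp: S_def)
    have "\<exists>V Y C. open V \<and> x \<in> V \<and> open Y \<and> y \<in> Y \<and> compact C \<and>
        (\<forall>f w. loc_isom f \<longrightarrow> f x \<in> Y \<longrightarrow> w \<in> V \<longrightarrow> f w \<in> C)" for y
    proof -
      obtain W C where W: "open W" "compact C" "y \<in> W" "W \<subseteq> C"
        using compact_neighbourhood[of UNIV y] by auto
      obtain V Y where "open V" "x \<in> V" "open Y" "y \<in> Y"
        "\<And>f z w. loc_isom f \<Longrightarrow> z \<in> V \<Longrightarrow> f z \<in> Y \<Longrightarrow> w \<in> V \<Longrightarrow> f w \<in> W"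
        using loc_isom_evenly_continuous[OF W(1,3), of x] by metis
      then show ?thesis using W by (intro exI[of _ V] exI[of _ Y] exI[of _ C]) blast
    qed
    then obtain V Y C where V: "\<And>y. open (V y)" "\<And>y. x \<in> V y" and Y: "\<And>y. open (Y y)" "\<And>y. y \<in> Y y"
      and C: "\<And>y. compact (C y)" "\<And>y f w. loc_isom f \<Longrightarrow> f x \<in> Y y \<Longrightarrow> w \<in> V y \<Longrightarrow> f w \<in> C y"
      by metis
    \<comment> \<open>Finitely many \<open>Y y\<close> cover the possible values \<open>f x\<close>.
      On the intersection of the corresponding \<open>V y\<close>, all maps of \<open>H\<close> take
      values in one finite union of compact sets.\<close>
    obtain D where D: "D \<subseteq> K" "finite D" "K \<subseteq> (\<Union>y\<in>D. Y y)"
      using compactE_image[OF K(1), of K Y] Y by blast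
    have "open (\<Inter>y\<in>D. V y)" using D(2) V(1) by (intro open_INT) auto
    moreover have "(\<Inter>y\<in>D. V y) \<subseteq> S"
    proof
      fix w assume w: "w \<in> (\<Inter>y\<in>D. V y)"
      have "compact (\<Union>y\<in>D. C y)" using D(2) C(1) by (intro compact_UN) auto
      moreover have "f w \<in> (\<Union>y\<in>D. C y)" if "f \<in> H" for f
        using K(2)[OF that] D(3) C(2)[OF li[OF that]] w by blast
      ultimately show "w \<in> S" by (auto simp: S_def)
    qed
    ultimately show "\<exists>T. open T \<and> x \<in> T \<and> T \<subseteq> S" using V(2) by blast
  qed
  moreover have "closure S \<subseteq> S"
  \<comment> \<open>For \<open>x'\<close> in \<open>S\<close> close to \<open>x\<close>, finitely many \<open>h\<close> suffice to bring \<open>f x'\<close> back near \<open>x'\<close> by \<open>h\<^sup>-\<^sup>1\<close>;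
    then \<open>h\<^sup>-\<^sup>1 \<circ> f\<close> maps \<open>x\<close> into a compact neighbourhood of \<open>x\<close>.\<close>
  proof
    fix x assume x: "x \<in> closure S"
    obtain W C where W: "open W" "compact C" "x \<in> W" "W \<subseteq> C"
      using compact_neighbourhood[of UNIV x] by auto
    obtain V Y where V: "open V" "x \<in> V" and Y: "open Y" "x \<in> Y"
      and VY: "\<And>f z w. loc_isom f \<Longrightarrow> z \<in> V \<Longrightarrow> f z \<in> Y \<Longrightarrow> w \<in> V \<Longrightarrow> f w \<in> W"
      using loc_isom_evenly_continuous[OF W(1,3), of x] by metis
    obtain x' where x': "x' \<in> S" "x' \<in> V" "x' \<in> Y"
      using x V Y unfolding closure_iff_nhds_not_empty by (metis Int_iff disjoint_iff open_Int subset_refl)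
    then obtain K where K: "compact K" "\<And>f. f \<in> H \<Longrightarrow> f x' \<in> K" by (auto simp: S_def)
    have "\<exists>V' Y'. open V' \<and> y \<in> V' \<and> x' \<in> Y' \<and>
        (\<forall>k z w. loc_isom k \<longrightarrow> z \<in> V' \<longrightarrow> k z \<in> Y' \<longrightarrow> w \<in> V' \<longrightarrow> k w \<in> Y)" for y
      using loc_isom_evenly_continuous[OF Y(1) x'(3), of y] by metis
    then obtain V' Y' where V': "\<And>y. open (V' y)" "\<And>y. y \<in> V' y" and Y': "\<And>y. x' \<in> Y' y"
      and V'Y': "\<And>y k z w. loc_isom k \<Longrightarrow> z \<in> V' y \<Longrightarrow> k z \<in> Y' y \<Longrightarrow> w \<in> V' y \<Longrightarrow> k w \<in> Y"
      by metis
    obtain D where D: "D \<subseteq> K" "finite D" "K \<subseteq> (\<Union>y\<in>D. V' y)"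
      using compactE_image[OF K(1), of K V'] V' by blast
    \<comment> \<open>One representative of \<open>H\<close> for each set of the cover that is hit;
      \<open>E\<close> keeps just those indices for which the choice is meaningful.\<close>
    define h where "h = (\<lambda>y. SOME f. f \<in> H \<and> f x' \<in> V' y)"
    define E where "E = {y \<in> D. \<exists>f\<in>H. f x' \<in> V' y}"
    have h: "h y \<in> H" "h y x' \<in> V' y" if "y \<in> E" for y
      using someI_ex[of "\<lambda>f. f \<in> H \<and> f x' \<in> V' y"] that by (auto simp: E_def h_def)
    have "compact (h y ` C)" if "y \<in> E" for y
      by (rule compact_continuous_image[OF continuous_on_subset[OF loc_isomD(1)[OF li[OF h(1)[OF that]]]] W(2)]) simp
    then have "compact (\<Union>y\<in>E. h y ` C)" using D(2) by (intro compact_UN) (auto simp: E_def)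
    moreover have "f x \<in> (\<Union>y\<in>E. h y ` C)" if f: "f \<in> H" for f
    proof -
      obtain y where y: "y \<in> D" "f x' \<in> V' y" using D(3) K(2)[OF f] by blast
      then have yE: "y \<in> E" using f by (auto simp: E_def)
      have hi: "h y \<in> isometries A g" using h(1)[OF yE] H by blast
      define k where "k = inv_into UNIV (h y)"
      have k: "loc_isom k" unfolding k_def by (rule isometry_inv_loc_isom[OF hi])
      have kh: "k (h y q) = q" "h y (k q) = q" for q using isometriesD(5,6)[OF hi] by (auto simp: k_def)
      \<comment> \<open>Both \<open>f x'\<close> and \<open>h y x'\<close> lie in
        \<open>V' y\<close>, and \<open>k\<close> takes the latter to \<open>x'\<close>. Even
        continuity of \<open>k\<close> therefore brings \<open>f x'\<close> into \<open>Y\<close>,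
        and even continuity of \<open>k \<circ> f\<close> then carries this from \<open>x'\<close>
        over to \<open>x\<close>.\<close>
      have "k (f x') \<in> Y" 
        by (rule V'Y'[OF k h(2)[OF yE] _ y(2)]) (simp add: kh Y')
      then have "(k \<circ> f) x \<in> W"
        using VY[OF loc_isom_comp[OF li[OF f] k] x'(2) _ V(2)] by simp
      then have "h y (k (f x)) \<in> h y ` C" using W(4) by auto
      then show ?thesis using yE kh by auto
    qed
    ultimately show "x \<in> S" by (auto simp: S_def)
  qed
  then have "closed S" by (simp only: closure_subset_eq)
  moreover have "p \<in> S" using p by (auto simp: S_def)
  ultimately have "S = UNIV" using conn[unfolded connected_clopen, rule_format, of S] by auto
  then have "x \<in> S" by simp
  then show ?thesis by (simp add: S_def)
qed

text \<open>Even continuity is used in both directions between \<open>x\<close> and a nearby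
  \<open>d\<close> of the dense set. Along a subsequence with limit \<open>y\<close> at
  \<open>x\<close>, it forces the limit at \<open>d\<close> to be near \<open>y\<close>; as the full
  sequence converges at \<open>d\<close>, it transfers back to \<open>x\<close> for all large
  indices. The compact \<open>C2\<close> is interposed because a limit of points of
  \<open>W2\<close> need not stay in \<open>W2\<close>.\<close>

lemma loc_isom_dense_convergent:
  assumes f: "\<And>n. loc_isom (f n)" and K: "compact K" "\<And>n. f n x \<in> K"
    and D: "\<And>V :: 'a set. open V \<Longrightarrow> V \<noteq> {} \<Longrightarrow> \<exists>d\<in>D. d \<in> V"
    and conv: "\<And>d. d \<in> D \<Longrightarrow> convergent (\<lambda>n. f n d)"
  shows "convergent (\<lambda>n. f n x)"
proof -
  obtain y r where y: "strict_mono (r :: nat \<Rightarrow> nat)" "((\<lambda>n. f n x) \<circ> r) \<longlonglongrightarrow> y"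
    using seq_compactE[OF compact_imp_seq_compact[OF K(1)], of "\<lambda>n. f n x"] K(2) by metis
  have "(\<lambda>n. f n x) \<longlonglongrightarrow> y"
  proof (rule topological_tendstoI)
    fix W assume W: "open W" "y \<in> W"
    obtain V1 Y1 where 1: "open V1" "x \<in> V1" "open Y1" "y \<in> Y1"
      "\<And>f z w. loc_isom f \<Longrightarrow> z \<in> V1 \<Longrightarrow> f z \<in> Y1 \<Longrightarrow> w \<in> V1 \<Longrightarrow> f w \<in> W"
      using loc_isom_evenly_continuous[OF W, of x] by metis
    obtain W2 C2 where 2: "open W2" "compact C2" "y \<in> W2" "W2 \<subseteq> C2" "C2 \<subseteq> Y1"
      using compact_neighbourhood[OF 1(3,4)] by metis
    obtain V3 Y3 where 3: "open V3" "x \<in> V3" "open Y3" "y \<in> Y3"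
      "\<And>f z w. loc_isom f \<Longrightarrow> z \<in> V3 \<Longrightarrow> f z \<in> Y3 \<Longrightarrow> w \<in> V3 \<Longrightarrow> f w \<in> W2"
      using loc_isom_evenly_continuous[OF 2(1,3), of x] by metis
    obtain d where d: "d \<in> D" "d \<in> V1" "d \<in> V3"
      using D[of "V1 \<inter> V3"] 1(1,2) 3(1,2) by auto
    obtain e where e: "(\<lambda>n. f n d) \<longlonglongrightarrow> e" using conv[OF d(1)] by (auto simp: convergent_def)
    have "\<forall>\<^sub>F n in sequentially. f (r n) d \<in> C2"
      using topological_tendstoD[OF y(2) 3(3,4)]
      by eventually_elim (use 2(4) 3(5)[OF f 3(2) _ d(3)] in auto)
    then have "e \<in> C2"
      using Lim_in_closed_set[OF compact_imp_closed[OF 2(2)] _ _ LIMSEQ_subseq_LIMSEQ[OF e y(1)]]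
      by (simp add: o_def)
    then have "e \<in> Y1" using 2(5) by blast
    from topological_tendstoD[OF e 1(3) this]
    show "\<forall>\<^sub>F n in sequentially. f n x \<in> W"
      by eventually_elim (use 1(5)[OF f d(2) _ 1(2)] in auto)
  qed
  then show ?thesis by (auto simp: convergent_def)
qed

lemma isometries_convergent_subsequence:
  assumes conn: "connected (UNIV :: 'a set)" and f: "\<And>n. f n \<in> isometries A g"
    and p: "(\<lambda>n. f n p) \<longlonglongrightarrow> q"
  obtains s l where "strict_mono (s :: nat \<Rightarrow> nat)" "\<And>x. (\<lambda>n. f (s n) x) \<longlonglongrightarrow> l x"
proof -
  obtain V C where "open V" "compact C" "q \<in> V" "V \<subseteq> C"
    using compact_neighbourhood[of UNIV q] by auto
  then obtain K0 where K0: "compact K0" "\<And>n. f n p \<in> K0"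
    using tendsto_imp_compact_superset[OF p] by metis
  have "range f \<subseteq> isometries A g" "\<And>h. h \<in> range f \<Longrightarrow> h p \<in> K0" using f K0(2) by auto
  from isometries_pointwise_relatively_compact[OF conn this(1) K0(1) this(2)]
  have "\<exists>K. compact K \<and> (\<forall>n. f n x \<in> K)" for x by simp
  then obtain K where K: "\<And>x. compact (K x)" "\<And>x n. f n x \<in> K x" by metis
  obtain D :: "'a set" where D: "countable D" "\<And>V. open V \<Longrightarrow> V \<noteq> {} \<Longrightarrow> \<exists>d\<in>D. d \<in> V"
    using countable_dense_setE by blast
  have "D \<noteq> {}" using D(2)[of UNIV] by auto
  define d where "d = from_nat_into D"
  have ds: "\<exists>n. d n = x" if "x \<in> D" for x
    using from_nat_into_surj[OF D(1) that] by (simp add: d_def)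
  interpret subseqs "\<lambda>n s. convergent (\<lambda>i. f (s i) (d n))"
  proof
    fix n and s :: "nat \<Rightarrow> nat"
    obtain l r where "strict_mono (r :: nat \<Rightarrow> nat)" "((\<lambda>i. f (s i) (d n)) \<circ> r) \<longlonglongrightarrow> l"
      using seq_compactE[OF compact_imp_seq_compact[OF K(1)], of "\<lambda>i. f (s i) (d n)" "d n"] K(2) by metis
    then show "\<exists>r. strict_mono r \<and> convergent (\<lambda>i. f ((s \<circ> r) i) (d n))"
      by (auto simp: convergent_def o_def)
  qed
  have cd: "convergent (\<lambda>i. f (diagseq i) (d n))" for n
  proof -
    \<comment> \<open>Only from index \<open>Suc n\<close> on is the diagonal sequence a subsequence
      of the one that converges at \<open>d n\<close>.\<close>
    have "convergent (\<lambda>i. f ((diagseq \<circ> (+) (Suc n)) i) (d n))"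
    proof (rule diagseq_holds)
      fix r s :: "nat \<Rightarrow> nat" and n
      assume "strict_mono r" "convergent (\<lambda>i. f (s i) (d n))"
      then show "convergent (\<lambda>i. f ((s \<circ> r) i) (d n))"
        using LIMSEQ_subseq_LIMSEQ[of "\<lambda>i. f (s i) (d n)"] by (auto simp: convergent_def o_def)
    qed
    then obtain l where "(\<lambda>i. f (diagseq (i + Suc n)) (d n)) \<longlonglongrightarrow> l"
      by (auto simp: convergent_def add.commute)
    then show ?thesis using LIMSEQ_offset[of "\<lambda>i. f (diagseq i) (d n)" "Suc n"] by (auto simp: convergent_def)
  qed
  have "convergent (\<lambda>i. f (diagseq i) x)" for x
  proof (rule loc_isom_dense_convergent[where f = "\<lambda>i. f (diagseq i)" and K = "K x" and x = x, OF _ K(1) K(2) D(2)])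
    show "loc_isom (f (diagseq n))" for n by (rule isometry_loc_isom[OF f])
    show "convergent (\<lambda>n. f (diagseq n) y)" if "y \<in> D" for y using cd ds[OF that] by metis
  qed
  then have "(\<lambda>i. f (diagseq i) x) \<longlonglongrightarrow> lim (\<lambda>i. f (diagseq i) x)" for x
    by (simp only: convergent_LIMSEQ_iff)
  then show ?thesis by (rule that[OF subseq_diagseq])
qed

section \<open>Locally uniform limits of isometries\<close>

text \<open>Even continuity upgrades pointwise to locally uniform convergence, stated with
  neighbourhoods so that it feeds directly into the compact-open topology.\<close>

lemma loc_isom_limit_locally_uniform:
  assumes f: "\<And>n. loc_isom (f n)" and lim: "\<And>x. (\<lambda>n. f n x) \<longlonglongrightarrow> l x"
    and W: "open W" "l x \<in> W"
  obtains V where "open V" "x \<in> V" "\<forall>\<^sub>F n in sequentially. f n ` V \<subseteq> W"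
proof -
  obtain V Y where *: "open V" "x \<in> V" "open Y" "l x \<in> Y"
    "\<And>f z w. loc_isom f \<Longrightarrow> z \<in> V \<Longrightarrow> f z \<in> Y \<Longrightarrow> w \<in> V \<Longrightarrow> f w \<in> W"
    using loc_isom_evenly_continuous[OF W, of x] by metis
  have "\<forall>\<^sub>F n in sequentially. f n ` V \<subseteq> W"
    using topological_tendstoD[OF lim *(3,4)] by eventually_elim (use *(5)[OF f *(2)] in blast)
  then show ?thesis using that * by blast
qed

lemma loc_isom_limit_continuous:
  assumes f: "\<And>n. loc_isom (f n)" and lim: "\<And>x. (\<lambda>n. f n x) \<longlonglongrightarrow> l x"
  shows "continuous_on UNIV l"
  unfolding continuous_on_open_vimage[OF open_UNIV]
proof (intro allI impI)
  fix W :: "'a set" assume "open W"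
  show "open (l -` W \<inter> UNIV)"
  proof (subst open_subopen, rule ballI)
    fix x assume "x \<in> l -` W \<inter> UNIV"
    then obtain B C where B: "open B" "compact C" "l x \<in> B" "B \<subseteq> C" "C \<subseteq> W"
      using compact_neighbourhood[OF \<open>open W\<close>, of "l x"] by auto
    obtain V where V: "open V" "x \<in> V" "\<forall>\<^sub>F n in sequentially. f n ` V \<subseteq> B"
      using loc_isom_limit_locally_uniform[OF f lim B(1,3)] by metis
    have "l ` V \<subseteq> C"
      by (rule eventually_image_subset_imp_limit_in_closed[OF lim V(3) B(4) compact_imp_closed[OF B(2)]])
    then show "\<exists>T. open T \<and> x \<in> T \<and> T \<subseteq> l -` W \<inter> UNIV" using V B(5) by blast
  qed
qed

lemma isometries_limit_smooth:
  assumes f: "\<And>n. f n \<in> isometries A g" and lim: "\<And>x. (\<lambda>n. f n x) \<longlonglongrightarrow> l x"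
  shows "smooth_map A l" "preserves_metric A g l"
proof -
  have li: "loc_isom (f n)" for n by (rule isometry_loc_isom[OF f])
  have cont: "continuous_on UNIV l" by (rule loc_isom_limit_continuous[OF li lim])
  have key: "\<exists>T. open T \<and> z \<in> T \<and> smooth_on T (local_rep c c' l) \<and>
      (\<forall>u v. g c' (local_rep c c' l z) (fder (local_rep c c' l) z u) (fder (local_rep c c' l) z v) = g c z u v)"
    if c: "c \<in> A" "c' \<in> A" and z: "z \<in> rep_dom c c' l" for c c' z
  proof -
    note cc = is_chartD[OF chart[OF c(1)]]
    note cc' = is_chartD[OF chart[OF c(2)]]
    define b where "b = local_rep c c' l z"
    have zc: "z \<in> chart_image c" "l (chart_inv c z) \<in> fst c'"
      using z by (auto simp: rep_dom_iff[OF chart[OF c(1)]])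
    then have b: "b \<in> chart_image c'" by (simp add: b_def local_rep_apply)
    obtain R where R: "R > 0" "cball b R \<subseteq> chart_image c'"
      using cc'(2) b open_contains_cball by metis
    define W where "W = chart_inv c' ` ball b R"
    have W: "open W" unfolding W_def by (rule cc'(9)) (use R in auto)
    have lW: "l (chart_inv c z) \<in> W"
      using cc'(3)[OF zc(2)] R(1) by (auto simp: W_def b_def local_rep_apply image_iff intro!: bexI[of _ b])
    have Wi: "q \<in> fst c'" "snd c' q \<in> cball b R" if q: "q \<in> W" for q
    proof -
      obtain w where w: "w \<in> ball b R" "q = chart_inv c' w" using q unfolding W_def by blast
      then have "w \<in> chart_image c'" using R(2) ball_subset_cball by blast
      then show "q \<in> fst c'" "snd c' q \<in> cball b R" using w cc'(4,5) by auto
    qed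
    obtain V where V: "open V" "chart_inv c z \<in> V" "\<forall>\<^sub>F n in sequentially. f n ` V \<subseteq> W"
      using loc_isom_limit_locally_uniform[OF li lim W lW] by metis
    \<comment> \<open>The coordinate result needs every term to map the closed ball into one compact
      subset of the chart, so the first \<open>N\<close> maps are dropped.\<close>
    then obtain N where N: "\<And>n. n \<ge> N \<Longrightarrow> f n ` V \<subseteq> W" by (auto simp: eventually_sequentially)
    define V' where "V' = V \<inter> fst c \<inter> l -` fst c'"
    have "open V'" unfolding V'_def using V(1) cc(1) cc'(1) cont by (simp add: open_vimage open_Int)
    then have "open (snd c ` V')" using cc(8)[of V'] by (auto simp: V'_def)
    moreover have "z \<in> snd c ` V'"
      using zc V(2) cc(4,5)[OF zc(1)] by (auto simp: V'_def image_iff intro!: bexI[of _ "chart_inv c z"])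
    ultimately obtain r where r: "r > 0" "cball z r \<subseteq> snd c ` V'"
      using open_contains_cball by blast
    have rV: "w \<in> chart_image c" "chart_inv c w \<in> V" "l (chart_inv c w) \<in> fst c'" if "w \<in> cball z r" for w
      using r(2) that cc(3) by (auto simp: V'_def)
    define F where "F = (\<lambda>n. local_rep c c' (f (n + N)))"
    define U where "U = (\<lambda>n. rep_dom c c' (f (n + N)))"
    have dom: "f (n + N) (chart_inv c w) \<in> W" if "w \<in> cball z r" for n w
      using N[of "n + N"] rV(2)[OF that] by auto
    have oU: "open (U n)" for n
      unfolding U_def by (rule open_rep_dom[OF chart[OF c(1)] chart[OF c(2)] loc_isomD(1)[OF li]])
    have sU: "cball z r \<subseteq> U n" for n
      using dom Wi(1) rV(1) by (auto simp: U_def rep_dom_iff[OF chart[OF c(1)]])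
    have UF: "U n \<subseteq> chart_image c" "F n ` U n \<subseteq> chart_image c'" for n
      by (auto simp: U_def F_def rep_dom_iff[OF chart[OF c(1)]] local_rep_apply)
    have smF: "smooth_on (U n) (F n)" for n
      using isometriesD(2)[OF f, of "n + N"] c by (simp add: smooth_map_def U_def F_def)
    have FK: "F n ` cball z r \<subseteq> cball b R" for n
      using dom Wi(2) unfolding F_def local_rep_apply by blast
    have iso: "g c' (F n w) (fder (F n) w u) (fder (F n) w v) = g c w u v" if "w \<in> U n" for n w u v
      unfolding F_def by (rule loc_isomD(3)[OF li c]) (use that in \<open>simp add: U_def\<close>)
    have limF: "(\<lambda>n. F n w) \<longlonglongrightarrow> local_rep c c' l w" if "w \<in> cball z r" for w
    proof -
      have "isCont (snd c') (l (chart_inv c w))"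
        using cc'(1,6) rV(3)[OF that] continuous_on_eq_continuous_at by blast
      then have "(\<lambda>n. snd c' (f n (chart_inv c w))) \<longlonglongrightarrow> snd c' (l (chart_inv c w))"
        using lim isCont_tendsto_compose by blast
      then show ?thesis unfolding F_def local_rep_apply by (rule LIMSEQ_ignore_initial_segment)
    qed
    have KS: "cball z r \<subseteq> chart_image c" using rV(1) by blast
    note res = isometric_limit[OF chart_metric_on[OF c(1)] chart_metric_on[OF c(2)] r(1) KS compact_cball R(2)
        oU sU UF(1) smF UF(2) FK iso limF]
    show ?thesis using res r(1) by (intro exI[of _ "ball z r"]) auto
  qed
  show "smooth_map A l"
    unfolding smooth_map_def smooth_on_def
  proof (intro conjI ballI allI cont Ck_on_local)
    fix c c' k z assume "c \<in> A" "c' \<in> A" "z \<in> rep_dom c c' l"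
    from key[OF this] obtain T where "open T" "z \<in> T" "smooth_on T (local_rep c c' l)" by blast
    then show "\<exists>T. open T \<and> z \<in> T \<and> Ck_on k T (local_rep c c' l)"
      by (auto simp: smooth_on_def)
  qed
  show "preserves_metric A g l"
    unfolding preserves_metric_def
  proof (intro ballI allI)
    fix c c' z u v assume "c \<in> A" "c' \<in> A" "z \<in> rep_dom c c' l"
    from key[OF this] show "g c' (local_rep c c' l z) (fder (local_rep c c' l) z u) (fder (local_rep c c' l) z v) = g c z u v"
      by blast
  qed
qed

text \<open>The limits of a sequence of isometries and of the sequence of their inverses are inverse to
  each other, since the convergence is locally uniform.\<close>

lemma limit_of_inverses:
  assumes k: "\<And>n. loc_isom (k n)" and f: "\<And>x. (\<lambda>n. f n x) \<longlonglongrightarrow> l x"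
    and klim: "\<And>x. (\<lambda>n. k n x) \<longlonglongrightarrow> m x" and kf: "\<And>n x. k n (f n x) = x"
  shows "m (l x) = x"
proof (rule ccontr)
  assume "m (l x) \<noteq> x"
  then obtain W W' where W: "open W" "open W'" "m (l x) \<in> W" "x \<in> W'" "W \<inter> W' = {}"
    using hausdorff by metis
  obtain V where V: "open V" "l x \<in> V" "\<forall>\<^sub>F n in sequentially. k n ` V \<subseteq> W"
    using loc_isom_limit_locally_uniform[OF k klim W(1,3)] by metis
  have "\<forall>\<^sub>F n in sequentially. x \<in> W"
    using V(3) topological_tendstoD[OF f V(1,2)] by eventually_elim (use kf in force)
  then show False using W by (auto simp: eventually_sequentially)
qed

lemma isometries_subsequence_limit:
  assumes conn: "connected (UNIV :: 'a set)" and f: "\<And>n. f n \<in> isometries A g"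
    and p: "(\<lambda>n. f n p) \<longlonglongrightarrow> q"
  obtains s l where "strict_mono (s :: nat \<Rightarrow> nat)" "l \<in> isometries A g"
    "\<And>x. (\<lambda>n. f (s n) x) \<longlonglongrightarrow> l x"
proof -
  obtain s l where s: "strict_mono s" "\<And>x. (\<lambda>n. f (s n) x) \<longlonglongrightarrow> l x"
    using isometries_convergent_subsequence[OF conn f p] by metis
  define k where "k = (\<lambda>n. inv_into UNIV (f (s n)))"
  have kl: "loc_isom (k n)" for n unfolding k_def by (rule isometry_inv_loc_isom[OF f])
  have kf: "k n (f (s n) x) = x" "f (s n) (k n x) = x" for n x
    using isometriesD(5,6)[OF f] by (auto simp: k_def)
  have ki: "k n \<in> isometries A g" for n
  proof -
    note i = isometriesD[OF f[of "s n"]]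
    have "inv_into UNIV (k n) = f (s n)" using i(1) by (simp add: k_def inv_inv_eq)
    moreover have "bij (k n)" using i(1) by (simp add: k_def bij_imp_bij_inv)
    ultimately show ?thesis 
      using i(2,3) kl[of n] by (simp add: isometries_def diffeomorphism_def loc_isom_def k_def)
  qed
  \<comment> \<open>Extraction of a subsequence requires convergence at one point. Since
    \<open>k n\<close> sends \<open>f (s n) p\<close> to \<open>p\<close> and these points tend to
    \<open>q\<close>, even continuity of the \<open>k n\<close> at \<open>q\<close> supplies
    it.\<close>
  have kq: "(\<lambda>n. k n q) \<longlonglongrightarrow> p"
  proof (rule topological_tendstoI)
    fix W assume W: "open W" "p \<in> W"
    obtain V Y where *: "open V" "q \<in> V" "p \<in> Y"
      "\<And>f z w. loc_isom f \<Longrightarrow> z \<in> V \<Longrightarrow> f z \<in> Y \<Longrightarrow> w \<in> V \<Longrightarrow> f w \<in> W"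
      using loc_isom_evenly_continuous[OF W, of q] by metis
    have "(\<lambda>n. f (s n) p) \<longlonglongrightarrow> q" using LIMSEQ_subseq_LIMSEQ[OF p s(1)] by (simp add: o_def)
    from topological_tendstoD[OF this *(1,2)]
    show "\<forall>\<^sub>F n in sequentially. k n q \<in> W"
      by eventually_elim (rule *(4)[OF kl _ _ *(2)], auto simp: kf *(3))
  qed
  \<comment> \<open>This second extraction serves only to show that \<open>l\<close> is invertible
    with smooth inverse; the maps \<open>f (s n)\<close> already converge to
    \<open>l\<close>.\<close>
  obtain t m where t: "strict_mono t" "\<And>x. (\<lambda>n. k (t n) x) \<longlonglongrightarrow> m x"
    using isometries_convergent_subsequence[OF conn ki kq] by metis
  have ft: "(\<lambda>n. f (s (t n)) x) \<longlonglongrightarrow> l x" for x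
    using LIMSEQ_subseq_LIMSEQ[OF s(2) t(1)] by (simp add: o_def)
  have ml: "m (l x) = x" for x
    by (rule limit_of_inverses[where k = "\<lambda>n. k (t n)" and f = "\<lambda>n. f (s (t n))", OF kl ft t(2) kf(1)])
  have lm: "l (m x) = x" for x
    by (rule limit_of_inverses[where k = "\<lambda>n. f (s (t n))" and f = "\<lambda>n. k (t n)",
          OF isometry_loc_isom[OF f] t(2) ft kf(2)])
  have "bij l" by (rule o_bij[of m]) (simp_all add: fun_eq_iff ml lm)
  moreover have "inv_into UNIV l = m" by (rule inv_unique_comp) (simp_all add: fun_eq_iff ml lm)
  ultimately have "l \<in> isometries A g"
    using isometries_limit_smooth[OF f ft] isometries_limit_smooth(1)[OF ki t(2)]
    by (simp add: isometries_def diffeomorphism_def)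
  then show ?thesis using that[OF s(1)] s(2) by blast
qed

section \<open>Closure in the compact-open topology\<close>

text \<open>For a subbasic set given by \<open>K\<close> and \<open>U\<close>, finitely many
  neighbourhoods of locally uniform convergence cover \<open>K\<close>, so eventually
  \<open>f n\<close> maps \<open>K\<close> into \<open>U\<close>.\<close>

lemma isometries_limit_in_closure:
  assumes G: "G \<subseteq> isometries A g" and f: "\<And>n. f n \<in> G" and l: "l \<in> isometries A g"
    and lim: "\<And>x. (\<lambda>n. f n x) \<longlonglongrightarrow> l x"
  shows "l \<in> isometry_topology A g closure_of G"
proof -
  have li: "loc_isom (f n)" for n using isometry_loc_isom f G by blast
  define \<S> where "\<S> = {{f :: 'a \<Rightarrow> 'a. f ` K \<subseteq> U} | K U. compact K \<and> open U}"
  \<comment> \<open>Induction on the generation of open sets: being eventually in a set passes to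
    finite intersections and to unions, so only subbasic sets need the geometry.\<close>
  have ev: "l \<in> T \<Longrightarrow> \<forall>\<^sub>F n in sequentially. f n \<in> T" if "generate_topology_on \<S> T" for T
    using that
  proof (induction rule: generate_topology_on.induct)
    case (Int a b)
    then show ?case by (auto intro: eventually_conj)
  next
    case (UN \<K>)
    then obtain T where T: "T \<in> \<K>" "l \<in> T" by blast
    from UN.IH[OF this] show ?case by eventually_elim (use T in blast)
  next
    case (Basis T)
    then obtain K U where T: "T = {f. f ` K \<subseteq> U}" and K: "compact K" "open U" by (auto simp: \<S>_def)
    have "\<exists>V. open V \<and> x \<in> V \<and> (\<forall>\<^sub>F n in sequentially. f n ` V \<subseteq> U)" if "x \<in> K" for x
      using loc_isom_limit_locally_uniform[OF li lim K(2), of x] Basis.prems that T by blast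
    then obtain V where V: "\<And>x. x \<in> K \<Longrightarrow> open (V x) \<and> x \<in> V x \<and> (\<forall>\<^sub>F n in sequentially. f n ` V x \<subseteq> U)"
      by metis
    obtain D where D: "D \<subseteq> K" "finite D" "K \<subseteq> (\<Union>x\<in>D. V x)"
      using compactE_image[OF K(1), of K V] V by blast
    have "\<forall>\<^sub>F n in sequentially. \<forall>x\<in>D. f n ` V x \<subseteq> U"
      by (rule eventually_ball_finite[OF D(2)]) (use D(1) V in blast)
    then show ?case by eventually_elim (use D(3) T in blast)
  qed auto
  have cont: "continuous_on UNIV h" if "h \<in> isometries A g" for h
    using loc_isomD(1)[OF isometry_loc_isom[OF that]] .
  \<comment> \<open>With empty \<open>K\<close> the subbasic set is the whole function space, so all
    isometries belong to the topological space.\<close>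
  have top: "topspace (isometry_topology A g) = isometries A g"
    unfolding isometry_topology_def compact_open_topology_def
    using cont by (auto intro!: exI[of _ "UNIV"] exI[of _ "{}"])
  show ?thesis
    unfolding in_closure_of top
  proof (intro conjI allI impI l)
    fix T assume T: "l \<in> T \<and> openin (isometry_topology A g) T"
    then obtain T' where T': "generate_topology_on \<S> T'" "T = (T' \<inter> {f. continuous_on UNIV f}) \<inter> isometries A g"
      unfolding isometry_topology_def compact_open_topology_def openin_subtopology
        openin_topology_generated_by_iff \<S>_def by blast
    have "\<forall>\<^sub>F n in sequentially. f n \<in> T'" using ev[OF T'(1)] T T'(2) by blast
    then obtain n where "f n \<in> T'" by (auto simp: eventually_sequentially)
    then have "f n \<in> T" using f[of n] G cont T'(2) by blast
    then show "\<exists>y. y \<in> G \<and> y \<in> T" using f by blast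
  qed
qed

lemma closure_orbit_subset:
  assumes "h \<in> isometry_topology A g closure_of G" 
  shows "h \<in> isometries A g" "h p \<in> closure ((\<lambda>f. f p) ` G)"
proof -
  have top: "topspace (isometry_topology A g) \<subseteq> isometries A g"
    by (auto simp: isometry_topology_def)
  then show hi: "h \<in> isometries A g" using assms by (auto simp: in_closure_of)
  show "h p \<in> closure ((\<lambda>f. f p) ` G)"
  proof (rule ccontr)
    assume *: "h p \<notin> closure ((\<lambda>f. f p) ` G)"
    define U where "U = - closure ((\<lambda>f. f p) ` G)"
    \<comment> \<open>The subbasic neighbourhood for the compact set \<open>{p}\<close>; this is the
      continuity of evaluation at \<open>p\<close>.\<close>
    define T where "T = ({f. f ` {p} \<subseteq> U} \<inter> {f. continuous_on UNIV f}) \<inter> isometries A g"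
    have "compact {p}" "open U" by (auto simp: U_def)
    then have "openin (topology_generated_by {{f. f ` K \<subseteq> U} | K U. compact K \<and> open U}) {f :: 'a \<Rightarrow> 'a. f ` {p} \<subseteq> U}"
      by (intro topology_generated_by_Basis) blast
    then have "openin (isometry_topology A g) T"
      unfolding T_def isometry_topology_def compact_open_topology_def openin_subtopology by blast
    moreover have "h \<in> T"
      using hi * loc_isomD(1)[OF isometry_loc_isom[OF hi]] by (auto simp: T_def U_def)
    ultimately obtain f where "f \<in> G" "f \<in> T" using assms by (auto simp: in_closure_of)
    then show False using closure_subset[of "(\<lambda>f. f p) ` G"] by (auto simp: T_def U_def)
  qed
qed

end

lemma subgroup_action_orbit_eq: "subgroup_action_orbit A g H p = (\<lambda>f. f p) ` H"
  by (auto simp: subgroup_action_orbit_def orbit_def)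

theorem theorem5:
  fixes A :: "('a::{t2_space,second_countable_topology}, 'e::euclidean_space) chart set"
    and g :: "('a, 'e) metric_tensor"
    and G :: "('a \<Rightarrow> 'a) set"
  assumes "riemannian_manifold A g"
    and "connected (UNIV :: 'a set)"
    and "complete_riemannian A g"
    and "subgroup G (isometry_group A g)"
  shows "(\<forall>p. closed (subgroup_action_orbit A g G p)) \<longleftrightarrow>
         orbit_equivalent A g G (isometry_topology A g closure_of G)"
proof -
  interpret riemannian A g by standard (rule assms(1))
  have G: "G \<subseteq> isometries A g"
    using subgroup.subset[OF assms(4)] by (simp add: isometry_group_def)
  let ?H = "isometry_topology A g closure_of G"
  \<comment> \<open>Each element of \<open>G\<close> is the limit of a constant sequence.\<close>
  have GH: "G \<subseteq> ?H"
    using isometries_limit_in_closure[OF G, of "\<lambda>n. f" f for f] G by auto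
  show ?thesis
    unfolding orbit_equivalent_def subgroup_action_orbit_eq
  proof
    assume "\<forall>p. closed ((\<lambda>f. f p) ` G)"
    then show "\<forall>p. (\<lambda>f. f p) ` G = (\<lambda>f. f p) ` ?H"
      using closure_orbit_subset(2)[of _ G] GH by (auto simp: closure_closed)
  next
    assume eq: "\<forall>p. (\<lambda>f. f p) ` G = (\<lambda>f. f p) ` ?H"
    show "\<forall>p. closed ((\<lambda>f. f p) ` G)"
    proof
      fix p
      have "closure ((\<lambda>f. f p) ` G) \<subseteq> (\<lambda>f. f p) ` G"
      proof
        fix q assume "q \<in> closure ((\<lambda>f. f p) ` G)"
        \<comment> \<open>Second countability of the manifold allows the closure of the orbit to be
          described by sequences.\<close>
        then obtain x where x: "\<And>n. x n \<in> (\<lambda>f. f p) ` G" "x \<longlonglongrightarrow> q"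
          unfolding closure_sequential by blast
        have "\<exists>h. h \<in> G \<and> x n = h p" for n using x(1)[of n] by blast
        then obtain f where f: "\<And>n. f n \<in> G" "\<And>n. x n = f n p" by metis
        then have fi: "f n \<in> isometries A g" for n using G by blast
        have lim: "(\<lambda>n. f n p) \<longlonglongrightarrow> q" using x(2) by (simp only: f(2)[symmetric])
        obtain s l where s: "strict_mono s" "l \<in> isometries A g" "\<And>x. (\<lambda>n. f (s n) x) \<longlonglongrightarrow> l x"
          using isometries_subsequence_limit[OF assms(2) fi lim] by metis
        have "l \<in> ?H" using isometries_limit_in_closure[OF G f(1) s(2,3)] .
        moreover have "l p = q"
          using LIMSEQ_unique[OF s(3) LIMSEQ_subseq_LIMSEQ[OF lim s(1), unfolded o_def]] .
        ultimately show "q \<in> (\<lambda>f. f p) ` G" using eq by blast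
      qed
      then show "closed ((\<lambda>f. f p) ` G)" by (simp only: closure_subset_eq)
    qed
  qed
qed

end
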